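(* The Göpel toric variety $\mathcal{T}$ has dimension $35$ in $\mathbb{P}^{134}$. It has $63$ distinguished boundary divisors, each given by the vanishing of one parameter $x_i$, $x_{ij}$, or $x_{ijk}$.
   Context: Consider $63$ formal variables (parameters): $x_i$ for $1\le i\le7$, $x_{ij}$ for $1\le i<j\le 7$, and $x_{ijk}$ for $1\le i<j<k\le7$ (indices are read as unordered sets), i.e. one parameter for each subset of $\{1,\ldots,7\}$ of cardinality $1$, $2$ or $3$. Consider the following $135$ seven-element sets of such subsets: (i) the $30$ Fano configurations, i.e. all images under permutations of $\{1,\ldots,7\}$ of $\{124,235,346,457,156,267,137\}$; (ii) the $105$ Pascal configurations, i.e. all images under permutations of $\{1,\ldots,7\}$ of $\{12,34,56,7,127,347,567\}$. (Under a suitable bijection of the $63$ subsets with the nonzero vectors of the symplectic space $(\mathbb{F}_2)^6$, these $135$ sets are the sets of nonzero vectors of the $135$ Lagrangian subspaces.) Let $m:\mathbb{P}^{62}\dashrightarrow\mathbb{P}^{134}$ be the monomial map whose $135$ coordinates are the squarefree degree $7$ monomials $\prod_{v\in\Lambda}x_v$, with $\Lambda$ running over these $135$ configurations. The Göpel toric variety $\mathcal{T}$ is the Zariski closure of the image of $m$. Let $\mathcal{A}\subset\mathbb{R}^{63}$ be the convex hull of the $135$ exponent vectors (the $0/1$ incidence vectors of the configurations); it is the polytope associated with the projective toric variety $\mathcal{T}$. The distinguished boundary divisor of $\mathcal{T}$ given by the vanishing of the parameter $x_v$ is the torus-invariant divisor corresponding to the facet of $\mathcal{A}$ on which the $v$-th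 coordinate of $\mathbb{R}^{63}$ vanishes. *)

theory Defs
  imports "HOL-Analysis.Analysis" "HOL-Library.Poly_Mapping"
begin

section \<open>Complex projective space with its Zariski topology\<close>

definition proj_rel :: "complex ^ 'n \<Rightarrow> complex ^ 'n \<Rightarrow> bool" where
  "proj_rel y z \<longleftrightarrow> y \<noteq> 0 \<and> (\<exists>c. c \<noteq> 0 \<and> z = c *s y)"

text \<open>The projective space of dimension \<open>CARD('n) - 1\<close>; the zero vector represents no point.\<close>

quotient_type 'n proj = "complex ^ 'n::finite" / partial: proj_rel
proof (rule part_equivpI)
  show "\<exists>y :: complex ^ 'n. proj_rel y y"
  proof
    show "proj_rel (1 :: complex ^ 'n) 1"
      unfolding proj_rel_def by (intro conjI exI[of _ 1]) (auto simp: vec_eq_iff)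
  qed
  show "symp (proj_rel :: complex ^ 'n \<Rightarrow> complex ^ 'n \<Rightarrow> bool)"
  proof (rule sympI)
    fix y z :: "complex ^ 'n"
    assume "proj_rel y z"
    then obtain c where "y \<noteq> 0" "c \<noteq> 0" "z = c *s y"
      by (auto simp: proj_rel_def)
    then have "z \<noteq> 0" "y = inverse c *s z" "inverse c \<noteq> 0"
      by (auto simp: vec_eq_iff)
    then show "proj_rel z y"
      unfolding proj_rel_def by blast
  qed
  show "transp (proj_rel :: complex ^ 'n \<Rightarrow> complex ^ 'n \<Rightarrow> bool)"
  proof (rule transpI)
    fix x y z :: "complex ^ 'n"
    assume "proj_rel x y" "proj_rel y z"
    then obtain c d where "x \<noteq> 0" "c \<noteq> 0" "y = c *s x" "d \<noteq> 0" "z = d *s y"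
      by (auto simp: proj_rel_def)
    then have "x \<noteq> 0" "d * c \<noteq> 0" "z = (d * c) *s x"
      by (auto simp: vec_eq_iff)
    then show "proj_rel x z"
      unfolding proj_rel_def by blast
  qed
qed

text \<open>\<open>'n mpoly\<close> is the polynomial ring over the complex numbers with variables indexed by \<open>'n\<close>:
  exponent vectors are mapped to coefficients.\<close>

type_synonym 'n mpoly = "('n \<Rightarrow>\<^sub>0 nat) \<Rightarrow>\<^sub>0 complex"

definition monom_eval :: "('n::finite \<Rightarrow>\<^sub>0 nat) \<Rightarrow> complex ^ 'n \<Rightarrow> complex" where
  "monom_eval a y = (\<Prod>i\<in>UNIV. (y $ i) ^ Poly_Mapping.lookup a i)"

definition mpoly_eval :: "'n::finite mpoly \<Rightarrow> complex ^ 'n \<Rightarrow> complex" where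
  "mpoly_eval p y = (\<Sum>a\<in>Poly_Mapping.keys p. Poly_Mapping.lookup p a * monom_eval a y)"

definition homogeneous_of :: "nat \<Rightarrow> 'n::finite mpoly \<Rightarrow> bool" where
  "homogeneous_of d p \<longleftrightarrow>
     (\<forall>a\<in>Poly_Mapping.keys p. (\<Sum>i\<in>UNIV. Poly_Mapping.lookup a i) = d)"

text \<open>Whether a homogeneous polynomial vanishes at a point does not depend on the chosen
  representative, so evaluating at \<open>rep_proj P\<close> is harmless.\<close>

definition proj_zeros :: "'n::finite mpoly set \<Rightarrow> 'n proj set" where
  "proj_zeros S = {P. \<forall>p\<in>S. mpoly_eval p (rep_proj P) = 0}"

definition zariski_closed :: "'n::finite proj set \<Rightarrow> bool" where
  "zariski_closed Z \<longleftrightarrow> (\<exists>S. (\<forall>p\<in>S. \<exists>d. homogeneous_of d p) \<and> Z = proj_zeros S)"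

definition zariski :: "'n::finite proj topology" where
  "zariski = topology (\<lambda>U. zariski_closed (- U))"

lemma monom_eval_add: "monom_eval (a + b) y = monom_eval a y * monom_eval b y"
  by (simp add: monom_eval_def lookup_add power_add prod.distrib)

lemma mpoly_eval_superset:
  assumes "finite A" "Poly_Mapping.keys p \<subseteq> A"
  shows "mpoly_eval p y = (\<Sum>a\<in>A. Poly_Mapping.lookup p a * monom_eval a y)"
  unfolding mpoly_eval_def
  by (rule sum.mono_neutral_left) (use assms in \<open>auto simp: in_keys_iff\<close>)

lemma mpoly_eval_add: "mpoly_eval (p + q) y = mpoly_eval p y + mpoly_eval q y"
proof -
  let ?A = "Poly_Mapping.keys p \<union> Poly_Mapping.keys q"
  have "mpoly_eval (p + q) y = (\<Sum>a\<in>?A. Poly_Mapping.lookup (p + q) a * monom_eval a y)"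
    by (rule mpoly_eval_superset) (auto simp: keys_add)
  also have "\<dots> = mpoly_eval p y + mpoly_eval q y"
    by (simp add: mpoly_eval_superset[of ?A] lookup_add algebra_simps sum.distrib)
  finally show ?thesis .
qed

lemma mpoly_eval_zero [simp]: "mpoly_eval 0 y = 0"
  by (simp add: mpoly_eval_def)

lemma mpoly_eval_sum: "mpoly_eval (sum f A) y = (\<Sum>x\<in>A. mpoly_eval (f x) y)"
  by (induction A rule: infinite_finite_induct) (auto simp: mpoly_eval_add)

lemma mpoly_eval_single: "mpoly_eval (Poly_Mapping.single a c) y = c * monom_eval a y"
  by (cases "c = 0") (auto simp: mpoly_eval_def)

lemma mpoly_sum_single:
  fixes p :: "'n::finite mpoly"
  shows "p = (\<Sum>a\<in>Poly_Mapping.keys p. Poly_Mapping.single a (Poly_Mapping.lookup p a))"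
proof (rule poly_mapping_eqI)
  fix k
  show "Poly_Mapping.lookup p k = Poly_Mapping.lookup
    (\<Sum>a\<in>Poly_Mapping.keys p. Poly_Mapping.single a (Poly_Mapping.lookup p a)) k"
    by (auto simp: lookup_sum lookup_single when_def sum.delta in_keys_iff)
qed

lemma mpoly_eval_mult:
  fixes p q :: "'n::finite mpoly"
  shows "mpoly_eval (p * q) y = mpoly_eval p y * mpoly_eval q y"
proof -
  let ?s = "\<lambda>p :: 'n mpoly. \<lambda>a. Poly_Mapping.single a (Poly_Mapping.lookup p a)"
  have "p * q = (\<Sum>a\<in>Poly_Mapping.keys p. ?s p a) * (\<Sum>b\<in>Poly_Mapping.keys q. ?s q b)"
    using mpoly_sum_single[of p] mpoly_sum_single[of q] by simp
  also have "\<dots> = (\<Sum>a\<in>Poly_Mapping.keys p. \<Sum>b\<in>Poly_Mapping.keys q.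
      Poly_Mapping.single (a + b) (Poly_Mapping.lookup p a * Poly_Mapping.lookup q b))"
    by (simp add: sum_product mult_single)
  finally have "mpoly_eval (p * q) y = (\<Sum>a\<in>Poly_Mapping.keys p. \<Sum>b\<in>Poly_Mapping.keys q.
      Poly_Mapping.lookup p a * Poly_Mapping.lookup q b * (monom_eval a y * monom_eval b y))"
    by (simp add: mpoly_eval_sum mpoly_eval_single monom_eval_add)
  also have "\<dots> = mpoly_eval p y * mpoly_eval q y"
    by (simp add: mpoly_eval_def sum_product algebra_simps)
  finally show ?thesis .
qed

lemma homogeneous_of_mult:
  fixes p q :: "'n::finite mpoly"
  assumes "homogeneous_of d p" "homogeneous_of e q"
  shows "homogeneous_of (d + e) (p * q)"
  unfolding homogeneous_of_def
proof
  fix c assume "c \<in> Poly_Mapping.keys (p * q)"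
  then obtain a b where "c = a + b" "a \<in> Poly_Mapping.keys p" "b \<in> Poly_Mapping.keys q"
    using keys_mult[of p q] by blast
  then show "(\<Sum>i\<in>UNIV. Poly_Mapping.lookup c i) = d + e"
    using assms by (simp add: homogeneous_of_def lookup_add sum.distrib)
qed

lemma zariski_closed_Un:
  assumes "zariski_closed A" "zariski_closed B"
  shows "zariski_closed (A \<union> B)"
proof -
  obtain S T where S: "\<forall>p\<in>S. \<exists>d. homogeneous_of d p" "A = proj_zeros S"
    and T: "\<forall>p\<in>T. \<exists>d. homogeneous_of d p" "B = proj_zeros T"
    using assms by (auto simp: zariski_closed_def)
  have "A \<union> B = proj_zeros {p * q | p q. p \<in> S \<and> q \<in> T}"
    unfolding S(2) T(2) proj_zeros_def
    by (auto simp: mpoly_eval_mult) (metis mpoly_eval_mult mult_eq_0_iff)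
  moreover have "\<forall>r\<in>{p * q | p q. p \<in> S \<and> q \<in> T}. \<exists>d. homogeneous_of d r"
    using S(1) T(1) homogeneous_of_mult by blast
  ultimately show ?thesis
    unfolding zariski_closed_def by blast
qed

lemma zariski_closed_Inter:
  assumes "\<And>Z. Z \<in> \<Z> \<Longrightarrow> zariski_closed Z"
  shows "zariski_closed (\<Inter>\<Z>)"
proof -
  obtain S where S: "\<And>Z. Z \<in> \<Z> \<Longrightarrow> (\<forall>p\<in>S Z. \<exists>d. homogeneous_of d p) \<and> Z = proj_zeros (S Z)"
    using assms unfolding zariski_closed_def by metis
  have "\<Inter>\<Z> = (\<Inter>Z\<in>\<Z>. proj_zeros (S Z))"
    using S by simp
  also have "\<dots> = proj_zeros (\<Union>Z\<in>\<Z>. S Z)"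
    unfolding proj_zeros_def by blast
  finally have "\<Inter>\<Z> = proj_zeros (\<Union>Z\<in>\<Z>. S Z)" .
  moreover have "\<forall>p\<in>(\<Union>Z\<in>\<Z>. S Z). \<exists>d. homogeneous_of d p"
    using S by simp
  ultimately show ?thesis
    unfolding zariski_closed_def by (intro exI conjI)
qed

lemma istopology_zariski: "istopology (\<lambda>U. zariski_closed (- U))"
  unfolding istopology_def
proof (intro conjI allI impI)
  fix S T :: "'n::finite proj set"
  assume "zariski_closed (- S)" "zariski_closed (- T)"
  then show "zariski_closed (- (S \<inter> T))"
    using zariski_closed_Un[of "- S" "- T"] by simp
next
  fix \<K> :: "'n::finite proj set set"
  assume "\<forall>K\<in>\<K>. zariski_closed (- K)"
  then have "zariski_closed (\<Inter> (uminus ` \<K>))"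
    by (intro zariski_closed_Inter) auto
  also have "\<Inter> (uminus ` \<K>) = - \<Union>\<K>"
    by auto
  finally show "zariski_closed (- \<Union>\<K>)" .
qed

lemma openin_zariski: "openin zariski U \<longleftrightarrow> zariski_closed (- U)"
  unfolding zariski_def by (simp add: topology_inverse'[OF istopology_zariski])

lemma topspace_zariski [simp]: "topspace (zariski :: 'n::finite proj topology) = UNIV"
proof -
  have "zariski_closed ({} :: 'n proj set)"
    unfolding zariski_closed_def
  proof (intro exI conjI)
    have "homogeneous_of 0 (1 :: 'n mpoly)"
      by (simp add: homogeneous_of_def)
    then show "\<forall>p\<in>{1 :: 'n mpoly}. \<exists>d. homogeneous_of d p"
      by blast
    show "{} = proj_zeros {1 :: 'n mpoly}"
      by (simp add: proj_zeros_def mpoly_eval_def monom_eval_def lookup_one)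
  qed
  then have "openin zariski (UNIV :: 'n proj set)"
    by (simp add: openin_zariski)
  then show ?thesis
    using openin_subset by blast
qed

lemma closedin_zariski: "closedin zariski Z \<longleftrightarrow> zariski_closed Z"
  by (simp add: closedin_def openin_zariski Compl_eq_Diff_UNIV[symmetric])


section \<open>Dimension and prime divisors\<close>

definition irreducible_closedin :: "'a topology \<Rightarrow> 'a set \<Rightarrow> bool" where
  "irreducible_closedin X Z \<longleftrightarrow> closedin X Z \<and> Z \<noteq> {} \<and>
     (\<forall>A B. closedin X A \<and> closedin X B \<and> Z = A \<union> B \<longrightarrow> Z = A \<or> Z = B)"

text \<open>The supremum is taken in \<^typ>\<open>enat\<close>, so the empty space gets dimension 0 rather than
  minus infinity.\<close>

definition krull_dim :: "'a topology \<Rightarrow> enat" where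
  "krull_dim X = Sup {enat n | n. \<exists>Z :: nat \<Rightarrow> 'a set.
     (\<forall>i\<le>n. irreducible_closedin X (Z i)) \<and> (\<forall>i<n. Z i \<subset> Z (Suc i))}"

definition zariski_dim :: "'n::finite proj set \<Rightarrow> enat" where
  "zariski_dim V = krull_dim (subtopology zariski V)"

definition prime_divisor :: "'n::finite proj set \<Rightarrow> 'n proj set \<Rightarrow> bool" where
  "prime_divisor V D \<longleftrightarrow>
     irreducible_closedin (subtopology zariski V) D \<and> zariski_dim D + 1 = zariski_dim V"


section \<open>Parameters and configurations\<close>

typedef goepel_param = "{S :: nat set. S \<subseteq> {1..7} \<and> card S \<in> {1, 2, 3}}"
  by (rule exI[of _ "{1}"]) auto

definition fano_base :: "nat set set" where
  "fano_base = {{1,2,4}, {2,3,5}, {3,4,6}, {4,5,7}, {1,5,6}, {2,6,7}, {1,3,7}}"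

definition pascal_base :: "nat set set" where
  "pascal_base = {{1,2}, {3,4}, {5,6}, {7}, {1,2,7}, {3,4,7}, {5,6,7}}"

definition fano_configs :: "nat set set set" where
  "fano_configs = {(`) \<sigma> ` fano_base | \<sigma>. \<sigma> permutes {1..7}}"

definition pascal_configs :: "nat set set set" where
  "pascal_configs = {(`) \<sigma> ` pascal_base | \<sigma>. \<sigma> permutes {1..7}}"

typedef goepel_config = "fano_configs \<union> pascal_configs"
  unfolding fano_configs_def using permutes_id by blast

lemma finite_params: "finite {S :: nat set. S \<subseteq> {1..7} \<and> card S \<in> {1, 2, 3}}"
  by (rule finite_subset[of _ "Pow {1..7}"]) auto

instance goepel_param :: finite
proof
  show "finite (UNIV :: goepel_param set)"
    unfolding type_definition.univ[OF type_definition_goepel_param]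
    using finite_params by (rule finite_imageI)
qed

instance goepel_config :: finite
proof
  have "finite fano_configs" "finite pascal_configs"
    unfolding fano_configs_def pascal_configs_def
    by (simp_all add: setcompr_eq_image finite_permutations)
  then show "finite (UNIV :: goepel_config set)"
    unfolding type_definition.univ[OF type_definition_goepel_config] by simp
qed

definition in_config :: "goepel_param \<Rightarrow> goepel_config \<Rightarrow> bool" where
  "in_config v \<Lambda> \<longleftrightarrow> Rep_goepel_param v \<in> Rep_goepel_config \<Lambda>"

text \<open>Passing to \<^typ>\<open>goepel_param\<close> loses no element of a configuration.\<close>

lemma config_subset_params:
  "Rep_goepel_config \<Lambda> \<subseteq> range Rep_goepel_param"
proof
  fix S assume S: "S \<in> Rep_goepel_config \<Lambda>"
  have base: "\<forall>T\<in>fano_base \<union> pascal_base. T \<subseteq> {1..7} \<and> card T \<in> {1, 2, 3}"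
    by (simp add: fano_base_def pascal_base_def)
  obtain \<sigma> B where \<sigma>: "\<sigma> permutes {1..7 :: nat}" and B: "B = fano_base \<or> B = pascal_base"
    and "Rep_goepel_config \<Lambda> = (`) \<sigma> ` B"
    using Rep_goepel_config[of \<Lambda>]
    unfolding fano_configs_def pascal_configs_def by blast
  then obtain T where T: "S = \<sigma> ` T" "T \<in> fano_base \<union> pascal_base"
    using S by blast
  then have T': "T \<subseteq> {1..7}" "card T \<in> {1, 2, 3}"
    using base by blast+
  have "card S = card T"
    using T(1) permutes_inj[OF \<sigma>] by (simp add: card_image inj_on_subset)
  moreover have "S \<subseteq> {1..7}"
    using T(1) T'(1) permutes_image[OF \<sigma>] image_mono by metis
  ultimately show "S \<in> range Rep_goepel_param"
    using T'(2) by (simp add: type_definition.Rep_range[OF type_definition_goepel_param])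
qed

section \<open>The toric variety\<close>

definition goepel_monomials :: "complex ^ goepel_param \<Rightarrow> complex ^ goepel_config" where
  "goepel_monomials x = (\<chi> \<Lambda>. \<Prod>v | in_config v \<Lambda>. x $ v)"

definition goepel_dom :: "goepel_param proj set" where
  "goepel_dom = {P. goepel_monomials (rep_proj P) \<noteq> 0}"

text \<open>The rational map \<open>m\<close>, meaningful only on \<^const>\<open>goepel_dom\<close>. All coordinates have degree 7,
  so the choice of representative is immaterial.\<close>

definition goepel_map :: "goepel_param proj \<Rightarrow> goepel_config proj" where
  "goepel_map P = abs_proj (goepel_monomials (rep_proj P))"

definition goepel_variety :: "goepel_config proj set" where
  "goepel_variety = zariski closure_of (goepel_map ` goepel_dom)"


section \<open>The polytope and its torus-invariant strata\<close>

definition exponent_vec :: "goepel_config \<Rightarrow> real ^ goepel_param" where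
  "exponent_vec \<Lambda> = (\<chi> v. if in_config v \<Lambda> then 1 else 0)"

definition goepel_polytope :: "(real ^ goepel_param) set" where
  "goepel_polytope = convex hull (range exponent_vec)"

definition coordinate_face :: "goepel_param \<Rightarrow> (real ^ goepel_param) set" where
  "coordinate_face v = {a \<in> goepel_polytope. a $ v = 0}"

definition torus :: "(complex ^ goepel_param) set" where
  "torus = {t. \<forall>v. t $ v \<noteq> 0}"

definition torus_act :: "complex ^ goepel_param \<Rightarrow> goepel_config proj \<Rightarrow> goepel_config proj" where
  "torus_act t P = abs_proj (\<chi> \<Lambda>. goepel_monomials t $ \<Lambda> * rep_proj P $ \<Lambda>)"

text \<open>The face-orbit correspondence: a face \<open>F\<close> of the polytope corresponds to the torus orbit
  of the point whose coordinates are 1 at the configurations with exponent vector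
  in \<open>F\<close> and 0 elsewhere; the invariant subvariety of \<open>F\<close> is the closure of that orbit.\<close>

definition distinguished_point :: "(real ^ goepel_param) set \<Rightarrow> goepel_config proj" where
  "distinguished_point F = abs_proj (\<chi> \<Lambda>. if exponent_vec \<Lambda> \<in> F then 1 else 0)"

definition face_subvariety :: "(real ^ goepel_param) set \<Rightarrow> goepel_config proj set" where
  "face_subvariety F =
     zariski closure_of ((\<lambda>t. torus_act t (distinguished_point F)) ` torus)"

definition boundary_divisor :: "goepel_param \<Rightarrow> goepel_config proj set" where
  "boundary_divisor v = face_subvariety (coordinate_face v)"

end

theory Submission
  imports Defs "HOL-Library.Nat_Bijection" "HOL-Combinatorics.Permutations"
begin

text \<open>
  Everything is read off from the incidence relation between the 63 parameters and the 135
  configurations. For a set \<open>K\<close> of parameters consider the points whose vanishing coordinates are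
  exactly those in \<open>K\<close>, and the Zariski closure of their image under the monomial map
  (\<open>toric in_config K {}\<close>). For \<open>K = {}\<close> this is the toric variety, and for \<open>K = {v}\<close> it is the
  boundary divisor of \<open>v\<close>: both the torus orbit of the distinguished point of the facet and the
  image of the whole coordinate hyperplane have this closure. These sets are irreducible because
  a product of two polynomials that vanishes on an affine space has a vanishing factor.

  Krull dimensions are bounded from above by counting. A chain of irreducible closed
  sets \<open>Z\<^sub>0 \<subset> \<dots> \<subset> Z\<^sub>n\<close> yields \<open>n\<close> homogeneous forms, the \<open>i\<close>-th vanishing on \<open>Z\<^sub>i\<close> but not on the next
  set, and suitably homogenised these are algebraically independent on \<open>Z\<^sub>n\<close>
  (\<open>chain_monomials_independent\<close>). So on \<open>Z\<^sub>n\<close> the number of independent forms of degree \<open>D\<close> grows at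
  least like the \<open>n\<close>-th power of \<open>D\<close>. On the other hand, forms of degree \<open>D\<close> pull back to
  combinations of the monomials whose exponent vectors are sums of \<open>D\<close> columns of the incidence
  matrix, and if the rows in a set \<open>B\<close> determine all rows by affine relations, there are at
  most \<open>(D + 1) ^ card B\<close> such vectors (\<open>zariski_dim_toric_le\<close>).

  They are bounded from below by freeing the parameters one by one, all others being set to 1
  (\<open>zariski_dim_toric_ge\<close>). Freeing \<open>b\<close> enlarges the closure as soon as two configurations agree on the
  parameters freed before and differ at \<open>b\<close>: the difference of their two coordinates separates the
  two closures. The same two kinds of data bound the dimensions of the polytope and of its faces.

  For the configurations, the 35 triples determine all other parameters
  (\<open>triples_determine_config\<close>), so the variety has dimension at most 35. For every \<open>v\<close> there is a
  sequence of 34 parameters that can be freed one by one within the configurations avoiding \<open>v\<close>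
  (\<open>certified\<close>), so each boundary divisor has dimension at least 34. Since it is a proper irreducible
  closed subset of the variety, the dimensions are exactly 34 and 35. By the symmetry under
  relabelling the seven points, sequences are needed for only three parameters; they
  are verified on an explicit list of the configurations, which also proves that there
  are 135 of them.
\<close>

section \<open>Homogeneous polynomials and Zariski closures\<close>

abbreviation vanishes_on :: "'n::finite mpoly \<Rightarrow> 'n proj set \<Rightarrow> bool" where
  "vanishes_on p Z \<equiv> \<forall>P\<in>Z. mpoly_eval p (rep_proj P) = 0"

lemma rep_proj_nonzero: "rep_proj P \<noteq> 0"
  using Quotient3_rep_reflp[OF Quotient3_proj, of P] by (simp add: proj_rel_def)

lemma abs_rep_proj: "abs_proj (rep_proj P) = P"
  by (rule Quotient3_abs_rep[OF Quotient3_proj])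

lemma proj_rel_abs_proj_iff:
  assumes "y \<noteq> 0" "z \<noteq> 0"
  shows "proj_rel y z \<longleftrightarrow> abs_proj y = abs_proj z"
proof -
  have "proj_rel y y" "proj_rel z z"
    using assms by (auto simp: proj_rel_def intro!: exI[of _ 1])
  then show ?thesis
    using Quotient3_rel[OF Quotient3_proj, of y z] by blast
qed

lemma rep_abs_proj:
  assumes "y \<noteq> 0"
  obtains c where "c \<noteq> 0" "rep_proj (abs_proj y) = c *s y"
proof -
  have "proj_rel y (rep_proj (abs_proj y))"
    using proj_rel_abs_proj_iff[OF assms rep_proj_nonzero] by (simp add: abs_rep_proj)
  then show thesis
    using that unfolding proj_rel_def by blast
qed

lemma abs_proj_scale:
  assumes "y \<noteq> 0" "c \<noteq> 0"
  shows "abs_proj (c *s y) = abs_proj y"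
proof -
  have "c *s y \<noteq> 0"
    using assms by (auto simp: vec_eq_iff)
  moreover have "proj_rel y (c *s y)"
    using assms unfolding proj_rel_def by blast
  ultimately show ?thesis
    using proj_rel_abs_proj_iff assms by metis
qed

lemma mpoly_eval_scale:
  assumes "homogeneous_of d p"
  shows "mpoly_eval p (c *s y) = c ^ d * mpoly_eval p y"
proof -
  have "monom_eval a (c *s y) = c ^ d * monom_eval a y" if "a \<in> Poly_Mapping.keys p" for a
  proof -
    have "monom_eval a (c *s y) = (\<Prod>i\<in>UNIV. c ^ Poly_Mapping.lookup a i) * monom_eval a y"
      by (simp add: monom_eval_def power_mult_distrib prod.distrib)
    also have "(\<Prod>i\<in>UNIV. c ^ Poly_Mapping.lookup a i) = c ^ d"
      using assms that by (simp add: homogeneous_of_def power_sum[symmetric])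
    finally show ?thesis .
  qed
  then show ?thesis
    by (simp add: mpoly_eval_def sum_distrib_left algebra_simps)
qed

lemma mpoly_eval_rep_abs_eq_0_iff:
  assumes "homogeneous_of d p" "y \<noteq> 0"
  shows "mpoly_eval p (rep_proj (abs_proj y)) = 0 \<longleftrightarrow> mpoly_eval p y = 0"
proof -
  obtain c where "c \<noteq> 0" "rep_proj (abs_proj y) = c *s y"
    using rep_abs_proj[OF assms(2)] .
  then show ?thesis
    by (simp add: mpoly_eval_scale[OF assms(1)])
qed

lemma mpoly_eval_one [simp]: "mpoly_eval 1 y = 1"
  by (simp add: mpoly_eval_def monom_eval_def lookup_one)

lemma mpoly_eval_power: "mpoly_eval (p ^ k) y = mpoly_eval p y ^ k"
  by (induction k) (simp_all add: mpoly_eval_mult)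

lemma homogeneous_of_one: "homogeneous_of 0 1"
  by (simp add: homogeneous_of_def)

lemma homogeneous_of_power: "homogeneous_of d p \<Longrightarrow> homogeneous_of (k * d) (p ^ k)"
  by (induction k) (simp_all add: homogeneous_of_one homogeneous_of_mult)

lemma homogeneous_of_add:
  "homogeneous_of d p \<Longrightarrow> homogeneous_of d q \<Longrightarrow> homogeneous_of d (p + q)"
  using keys_add[of p q] by (auto simp: homogeneous_of_def)

lemma homogeneous_of_sum:
  "(\<And>x. x \<in> A \<Longrightarrow> homogeneous_of d (f x)) \<Longrightarrow> homogeneous_of d (sum f A)"
  by (induction A rule: infinite_finite_induct)
    (auto simp: homogeneous_of_add, auto simp: homogeneous_of_def)

abbreviation const_mpoly :: "complex \<Rightarrow> 'n::finite mpoly" where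
  "const_mpoly c \<equiv> Poly_Mapping.single 0 c"

lemma mpoly_eval_const [simp]: "mpoly_eval (const_mpoly c) y = c"
  by (simp add: mpoly_eval_single monom_eval_def)

lemma homogeneous_of_const_mult: "homogeneous_of d p \<Longrightarrow> homogeneous_of d (const_mpoly c * p)"
  using homogeneous_of_mult[of 0 "const_mpoly c" d p] by (simp add: homogeneous_of_def)

definition var_mpoly :: "'n::finite \<Rightarrow> 'n mpoly" where
  "var_mpoly i = Poly_Mapping.single (Poly_Mapping.single i 1) 1"

lemma mpoly_eval_var [simp]: "mpoly_eval (var_mpoly i) y = y $ i"
proof -
  have "(\<Prod>j\<in>UNIV. (y $ j) ^ (Poly_Mapping.lookup (Poly_Mapping.single i (1::nat)) j))
      = (\<Prod>j\<in>UNIV. if j = i then y $ j else 1)"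
    by (rule prod.cong) (auto simp: lookup_single when_def)
  then show ?thesis
    by (simp add: var_mpoly_def mpoly_eval_single monom_eval_def)
qed

lemma homogeneous_of_var: "homogeneous_of 1 (var_mpoly i)"
  by (simp add: var_mpoly_def homogeneous_of_def lookup_single when_def)

lemma closedin_zeros:
  assumes "homogeneous_of d p"
  shows "closedin zariski (proj_zeros {p})"
  unfolding closedin_zariski zariski_closed_def using assms by blast

text \<open>A closed set is an intersection of zero sets of homogeneous polynomials, so membership in a closure
  can be tested with one such polynomial at a time. All statements about closures below are reduced
  to statements about polynomials by this criterion.\<close>

lemma zariski_closure_iff:
  "P \<in> zariski closure_of Y \<longleftrightarrow>
    (\<forall>d p. homogeneous_of d p \<longrightarrow> vanishes_on p Y \<longrightarrow> mpoly_eval p (rep_proj P) = 0)"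
proof
  assume P: "P \<in> zariski closure_of Y"
  show "\<forall>d p. homogeneous_of d p \<longrightarrow> vanishes_on p Y \<longrightarrow> mpoly_eval p (rep_proj P) = 0"
  proof (intro allI impI)
    fix d p assume p: "homogeneous_of d p" "vanishes_on p Y"
    then have "zariski closure_of Y \<subseteq> proj_zeros {p}"
      by (intro closure_of_minimal closedin_zeros[OF p(1)]) (auto simp: proj_zeros_def)
    then show "mpoly_eval p (rep_proj P) = 0"
      using P by (auto simp: proj_zeros_def)
  qed
next
  assume P: "\<forall>d p. homogeneous_of d p \<longrightarrow> vanishes_on p Y \<longrightarrow> mpoly_eval p (rep_proj P) = 0"
  have "closedin zariski (zariski closure_of Y)"
    by simp
  then obtain S where S: "\<forall>p\<in>S. \<exists>d. homogeneous_of d p" "zariski closure_of Y = proj_zeros S"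
    unfolding closedin_zariski zariski_closed_def by blast
  have "Y \<subseteq> proj_zeros S"
    using closure_of_subset[of Y zariski] S(2) by simp
  then show "P \<in> zariski closure_of Y"
    using P S by (fastforce simp: proj_zeros_def)
qed

section \<open>Irreducible sets and chains\<close>

lemma irreducible_closedin_subtopology_iff:
  assumes "closedin X V"
  shows "irreducible_closedin (subtopology X V) Z \<longleftrightarrow> irreducible_closedin X Z \<and> Z \<subseteq> V"
  unfolding irreducible_closedin_def closedin_closed_subtopology[OF assms] by blast

text \<open>The homogeneous vanishing ideal of an irreducible set is prime: the set is covered by its
  intersections with the two zero sets.\<close>

lemma irreducible_vanishes_on_mult:
  assumes Z: "irreducible_closedin zariski Z"
    and hom: "homogeneous_of d p" "homogeneous_of e q"
    and pq: "vanishes_on (p * q) Z"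
  shows "vanishes_on p Z \<or> vanishes_on q Z"
proof -
  have "closedin zariski (Z \<inter> proj_zeros {p})" "closedin zariski (Z \<inter> proj_zeros {q})"
    using Z hom by (auto simp: irreducible_closedin_def intro: closedin_zeros)
  moreover have "Z = (Z \<inter> proj_zeros {p}) \<union> (Z \<inter> proj_zeros {q})"
    using pq by (auto simp: proj_zeros_def mpoly_eval_mult)
  ultimately have "Z = Z \<inter> proj_zeros {p} \<or> Z = Z \<inter> proj_zeros {q}"
    using Z unfolding irreducible_closedin_def by blast
  then show ?thesis
    by (auto simp: proj_zeros_def)
qed

lemma irreducible_vanishes_on_power:
  assumes Z: "irreducible_closedin zariski Z"
    and hom: "homogeneous_of d p" "homogeneous_of e q"
    and pq: "vanishes_on (p ^ k * q) Z"
  shows "vanishes_on p Z \<or> vanishes_on q Z"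
  using pq
proof -
  have "vanishes_on (p ^ k) Z \<or> vanishes_on q Z"
    using irreducible_vanishes_on_mult[OF Z homogeneous_of_power[OF hom(1)] hom(2) pq] .
  then show ?thesis
    by (auto simp: mpoly_eval_power)
qed

text \<open>Conversely, a set with a prime vanishing ideal has an irreducible closure: a polynomial for each of
  two proper closed parts would give a product that vanishes on the set.\<close>

lemma irreducible_zariski_closure:
  assumes ne: "Y \<noteq> {}"
    and prime: "\<And>d e p q. homogeneous_of d p \<Longrightarrow> homogeneous_of e q \<Longrightarrow>
      vanishes_on (p * q) Y \<Longrightarrow> vanishes_on p Y \<or> vanishes_on q Y"
  shows "irreducible_closedin zariski (zariski closure_of Y)"
  unfolding irreducible_closedin_def
proof (intro conjI allI impI)
  let ?C = "zariski closure_of Y"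
  have sub: "Y \<subseteq> ?C"
    by (simp add: closure_of_subset)
  then show "?C \<noteq> {}"
    using ne by blast
  fix A B assume AB: "closedin zariski A \<and> closedin zariski B \<and> ?C = A \<union> B"
  obtain S T where S: "\<forall>p\<in>S. \<exists>d. homogeneous_of d p" "A = proj_zeros S"
    and T: "\<forall>p\<in>T. \<exists>d. homogeneous_of d p" "B = proj_zeros T"
    using AB unfolding closedin_zariski zariski_closed_def by blast
  show "?C = A \<or> ?C = B"
  proof (rule ccontr)
    assume "\<not> ?thesis"
    then have "\<not> ?C \<subseteq> A" "\<not> ?C \<subseteq> B"
      using AB by blast+
    then obtain P Q where PQ: "P \<in> ?C" "P \<notin> A" "Q \<in> ?C" "Q \<notin> B"
      by blast
    obtain p where p: "p \<in> S" "mpoly_eval p (rep_proj P) \<noteq> 0"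
      using PQ(2) S(2) by (auto simp: proj_zeros_def)
    obtain q where q: "q \<in> T" "mpoly_eval q (rep_proj Q) \<noteq> 0"
      using PQ(4) T(2) by (auto simp: proj_zeros_def)
    obtain d e where hom: "homogeneous_of d p" "homogeneous_of e q"
      using p(1) q(1) S(1) T(1) by blast
    have "mpoly_eval (p * q) (rep_proj R) = 0" if "R \<in> Y" for R
    proof -
      have "R \<in> proj_zeros S \<union> proj_zeros T"
        using sub that AB unfolding S(2) T(2) by blast
      then show ?thesis
        using p(1) q(1) by (auto simp: proj_zeros_def mpoly_eval_mult)
    qed
    moreover have "\<not> vanishes_on p Y"
      using PQ(1) p(2) hom(1) unfolding zariski_closure_iff by blast
    moreover have "\<not> vanishes_on q Y"
      using PQ(3) q(2) hom(2) unfolding zariski_closure_iff by blast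
    ultimately show False
      using prime[OF hom] by blast
  qed
qed simp

definition irreducible_chain :: "'a topology \<Rightarrow> nat \<Rightarrow> (nat \<Rightarrow> 'a set) \<Rightarrow> bool" where
  "irreducible_chain X n Z \<longleftrightarrow>
    (\<forall>i\<le>n. irreducible_closedin X (Z i)) \<and> (\<forall>i<n. Z i \<subset> Z (Suc i))"

lemma krull_dim_ge: "irreducible_chain X n Z \<Longrightarrow> enat n \<le> krull_dim X"
  unfolding krull_dim_def irreducible_chain_def by (rule Sup_upper) blast

lemma krull_dim_le:
  assumes "\<And>Z n. irreducible_chain X n Z \<Longrightarrow> n \<le> r"
  shows "krull_dim X \<le> enat r"
  unfolding krull_dim_def
proof (rule Sup_least)
  fix x assume "x \<in> {enat n | n. \<exists>Z. (\<forall>i\<le>n. irreducible_closedin X (Z i)) \<and> (\<forall>i<n. Z i \<subset> Z (Suc i))}"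
  then obtain n Z where "x = enat n" "irreducible_chain X n Z"
    unfolding irreducible_chain_def by blast
  then show "x \<le> enat r"
    using assms by simp
qed

lemma irreducible_chain_mono: "irreducible_chain X n Z \<Longrightarrow> i \<le> n \<Longrightarrow> Z i \<subseteq> Z n"
proof (induction n)
  case (Suc n)
  then have "irreducible_chain X n Z" "Z n \<subset> Z (Suc n)"
    by (simp_all add: irreducible_chain_def)
  with Suc show ?case
    by (cases "i = Suc n") auto
qed simp

lemma irreducible_chain_subtopology_iff:
  assumes "closedin X V"
  shows "irreducible_chain (subtopology X V) n Z \<longleftrightarrow> irreducible_chain X n Z \<and> Z n \<subseteq> V"
  using irreducible_chain_mono[of X n Z]
  unfolding irreducible_chain_def irreducible_closedin_subtopology_iff[OF assms]
  by (meson order.refl order.trans)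

lemma irreducible_chain_extend:
  assumes "irreducible_chain X n Z" "irreducible_closedin X V" "Z n \<subset> V"
  shows "irreducible_chain X (Suc n) (Z(Suc n := V))"
  using assms by (auto simp: irreducible_chain_def le_Suc_eq less_Suc_eq)

text \<open>A chain in the smaller set is extended by the larger one. Irreducibility of \<open>D\<close> excludes the
  empty set, whose dimension is 0 by convention, so that it could have the same dimension as a point.\<close>

lemma zariski_dim_proper_subset:
  assumes D: "irreducible_closedin zariski D" and V: "irreducible_closedin zariski V"
    and DV: "D \<subset> V"
  shows "zariski_dim D + 1 \<le> zariski_dim V"
proof -
  have closed: "closedin zariski D" "closedin zariski V"
    using D V by (simp_all add: irreducible_closedin_def)
  have "zariski_dim D + 1 \<le> enat m" if fin: "zariski_dim V = enat m" for m
  proof -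
    have chain: "Suc n \<le> m" if "irreducible_chain zariski n Z" "Z n \<subseteq> D" for n Z
    proof -
      have "irreducible_chain zariski (Suc n) (Z(Suc n := V))"
        using irreducible_chain_extend[OF that(1) V] that(2) DV by blast
      then have "irreducible_chain (subtopology zariski V) (Suc n) (Z(Suc n := V))"
        by (simp add: irreducible_chain_subtopology_iff[OF closed(2)])
      then have "enat (Suc n) \<le> enat m"
        unfolding fin[symmetric] zariski_dim_def by (rule krull_dim_ge)
      then show ?thesis
        by simp
    qed
    have "irreducible_chain zariski 0 (\<lambda>_. D)"
      using D by (simp add: irreducible_chain_def)
    then have m: "0 < m"
      using chain[of 0 "\<lambda>_. D"] by simp
    have "zariski_dim D \<le> enat (m - 1)"
      unfolding zariski_dim_def
    proof (rule krull_dim_le)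
      fix Z n assume "irreducible_chain (subtopology zariski D) n Z"
      then show "n \<le> m - 1"
        using chain[of n Z] by (simp add: irreducible_chain_subtopology_iff[OF closed(1)])
    qed
    then have "zariski_dim D + 1 \<le> enat (m - 1) + 1"
      by (rule add_right_mono)
    then show ?thesis
      using m by (simp add: one_enat_def)
  qed
  then show ?thesis
    by (cases "zariski_dim V") auto
qed

section \<open>An upper bound for the length of chains\<close>

text \<open>A homogeneous linear system with more unknowns than equations has a nonzero solution; one equation
  is eliminated at a time, with \<open>p\<close> as the pivot unknown.\<close>

lemma underdetermined_system:
  fixes A :: "'i \<Rightarrow> 'u \<Rightarrow> 'a::field"
  assumes "finite U" "finite I" "card U < card I"
  shows "\<exists>c. (\<exists>i\<in>I. c i \<noteq> 0) \<and> (\<forall>u\<in>U. (\<Sum>i\<in>I. c i * A i u) = 0)"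
  using assms
proof (induction U arbitrary: I A rule: finite_induct)
  case empty
  then have "I \<noteq> {}"
    by auto
  then show ?case
    by (intro exI[of _ "\<lambda>_. 1"]) auto
next
  case (insert u U)
  show ?case
  proof (cases "\<forall>i\<in>I. A i u = 0")
    case True
    obtain c where "\<exists>i\<in>I. c i \<noteq> 0" "\<forall>w\<in>U. (\<Sum>i\<in>I. c i * A i w) = 0"
      using insert.IH[OF insert.prems(1), of A] insert.prems insert.hyps by auto
    then show ?thesis
      using True by (intro exI[of _ c]) simp
  next
    case False
    then obtain p where p: "p \<in> I" "A p u \<noteq> 0"
      by blast
    define J where "J = I - {p}"
    define B where "B i w = A i w - A i u / A p u * A p w" for i w
    have J: "finite J" "card U < card J" "p \<notin> J" "I = insert p J"
      using insert.prems insert.hyps p by (auto simp: J_def)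
    obtain c where c: "\<exists>i\<in>J. c i \<noteq> 0" "\<And>w. w \<in> U \<Longrightarrow> (\<Sum>i\<in>J. c i * B i w) = 0"
      using insert.IH[OF J(1,2), of B] by blast
    define a where "a = - (\<Sum>i\<in>J. c i * A i u) / A p u"
    have sum: "(\<Sum>i\<in>I. (c(p := a)) i * A i w) = (\<Sum>i\<in>J. c i * B i w)" for w
    proof -
      have "(\<Sum>i\<in>I. (c(p := a)) i * A i w) = a * A p w + (\<Sum>i\<in>J. (c(p := a)) i * A i w)"
        using J by simp
      also have "(\<Sum>i\<in>J. (c(p := a)) i * A i w) = (\<Sum>i\<in>J. c i * A i w)"
        using J(3) by (intro sum.cong) auto
      also have "a * A p w = - (\<Sum>i\<in>J. c i * (A i u / A p u * A p w))"
        by (simp add: a_def sum_distrib_right sum_divide_distrib mult.assoc)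
      finally show ?thesis
        by (simp add: B_def right_diff_distrib sum_subtractf)
    qed
    have "(\<Sum>i\<in>J. c i * B i u) = 0"
      using p(2) by (simp add: B_def)
    then have "\<forall>w\<in>insert u U. (\<Sum>i\<in>I. (c(p := a)) i * A i w) = 0"
      unfolding sum using c(2) by blast
    moreover have "\<exists>i\<in>I. (c(p := a)) i \<noteq> 0"
      using c(1) J(3,4) by auto
    ultimately show ?thesis
      by blast
  qed
qed

text \<open>The step of the independence argument. On \<open>Y\<close> the form \<open>f\<close> vanishes, so only the summand with \<open>k = 0\<close>
  survives there, and as \<open>g\<close> does not vanish on the irreducible set \<open>Y\<close>, the coefficient \<open>h 0\<close> does. By
  assumption it then vanishes on all of \<open>Z\<close>, the remaining sum is divisible by \<open>f\<close>, and \<open>f\<close> can be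
  cancelled because \<open>Z\<close> is irreducible.\<close>

lemma pencil_coefficients_vanish:
  assumes Y: "irreducible_closedin zariski Y" and Z: "irreducible_closedin zariski Z"
    and YZ: "Y \<subseteq> Z"
    and f: "homogeneous_of e f" "vanishes_on f Y" "\<not> vanishes_on f Z"
    and g: "homogeneous_of e g" "\<not> vanishes_on g Y"
    and h: "\<And>k. k \<le> M \<Longrightarrow> homogeneous_of d (h k)"
      "\<And>k. k \<le> M \<Longrightarrow> vanishes_on (h k) Y \<Longrightarrow> vanishes_on (h k) Z"
    and sum: "vanishes_on (\<Sum>k\<le>M. f ^ k * g ^ (M - k) * h k) Z"
    and k: "k \<le> M"
  shows "vanishes_on (h k) Y"
  using h sum k
proof (induction M arbitrary: h k)
  case 0
  then show ?case
    using YZ by auto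
next
  case (Suc M)
  define s where "s = (\<Sum>k\<le>M. f ^ k * g ^ (M - k) * h (Suc k))"
  have split: "(\<Sum>k\<le>Suc M. f ^ k * g ^ (Suc M - k) * h k) = g ^ Suc M * h 0 + f * s"
    by (simp add: sum.atMost_Suc_shift s_def sum_distrib_left mult.assoc del: sum.atMost_Suc power_Suc2)
  have "mpoly_eval (g ^ Suc M * h 0) (rep_proj P) = 0" if "P \<in> Y" for P
  proof -
    have "mpoly_eval (g ^ Suc M * h 0 + f * s) (rep_proj P) = 0"
      using Suc.prems(3) YZ that unfolding split by blast
    moreover have "mpoly_eval (f * s) (rep_proj P) = 0"
      using f(2) that by (simp add: mpoly_eval_mult)
    ultimately show ?thesis
      by (simp add: mpoly_eval_add)
  qed
  then have h0: "vanishes_on (h 0) Y"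
    using irreducible_vanishes_on_power[OF Y g(1) Suc.prems(1)[of 0], of "Suc M"] g(2) by blast
  then have "vanishes_on (h 0) Z"
    using Suc.prems(2)[of 0] by simp
  then have "vanishes_on (f * s) Z"
    using Suc.prems(3) unfolding split by (simp add: mpoly_eval_add mpoly_eval_mult)
  moreover have "homogeneous_of (M * e + d) s"
    unfolding s_def
  proof (rule homogeneous_of_sum)
    fix k assume "k \<in> {..M}"
    then have "M * e + d = k * e + (M - k) * e + d"
      by (simp flip: add_mult_distrib)
    then show "homogeneous_of (M * e + d) (f ^ k * g ^ (M - k) * h (Suc k))"
      using \<open>k \<in> {..M}\<close> Suc.prems(1)[of "Suc k"] f(1) g(1)
      by (simp add: homogeneous_of_mult homogeneous_of_power)
  qed
  ultimately have s: "vanishes_on s Z"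
    using irreducible_vanishes_on_mult[OF Z f(1)] f(3) by blast
  show ?case
  proof (cases k)
    case 0
    then show ?thesis
      using h0 by simp
  next
    case (Suc j)
    have "vanishes_on (h (Suc j)) Y"
    proof (rule Suc.IH[where h = "\<lambda>k. h (Suc k)" and k = j])
      show "homogeneous_of d (h (Suc i))" if "i \<le> M" for i
        using Suc.prems(1) that by simp
      show "vanishes_on (h (Suc i)) Z" if "i \<le> M" "vanishes_on (h (Suc i)) Y" for i
        using Suc.prems(2)[of "Suc i"] that by simp
      show "vanishes_on (\<Sum>k\<le>M. f ^ k * g ^ (M - k) * h (Suc k)) Z"
        using s unfolding s_def .
      show "j \<le> M"
        using Suc.prems(4) Suc by simp
    qed
    then show ?thesis
      by (simp add: Suc)
  qed
qed

text \<open>The monomials in the forms \<open>f i\<close> with exponents at most \<open>M\<close>. Each power of \<open>f i\<close> is completed by a power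
  of a form \<open>g i\<close> of the same degree, so that the total degree does not depend on the exponents. The
  head of the exponent list belongs to the form with the largest index, as the induction along the
  chain removes the top set first.\<close>

fun chain_monomial ::
  "nat \<Rightarrow> (nat \<Rightarrow> 'n::finite mpoly) \<Rightarrow> (nat \<Rightarrow> 'n mpoly) \<Rightarrow> nat list \<Rightarrow> 'n mpoly" where
  "chain_monomial M f g [] = 1"
| "chain_monomial M f g (k # ks) =
    f (length ks) ^ k * g (length ks) ^ (M - k) * chain_monomial M f g ks"

abbreviation exponent_lists :: "nat \<Rightarrow> nat \<Rightarrow> nat list set" where
  "exponent_lists M n \<equiv> {ks. set ks \<subseteq> {..M} \<and> length ks = n}"

lemma sum_exponent_lists_Suc:
  "(\<Sum>ks\<in>exponent_lists M (Suc n). F ks) = (\<Sum>k\<le>M. \<Sum>ks\<in>exponent_lists M n. F (k # ks))"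
proof -
  have "(\<Sum>ks\<in>exponent_lists M (Suc n). F ks) =
      (\<Sum>(k, ks)\<in>{..M} \<times> exponent_lists M n. F (k # ks))"
    by (rule sum.reindex_bij_witness[of _ "\<lambda>(k, ks). k # ks" "\<lambda>ks. (hd ks, tl ks)"])
      (auto simp: length_Suc_conv)
  then show ?thesis
    by (simp add: sum.cartesian_product)
qed

lemma homogeneous_chain_monomial:
  assumes "ks \<in> exponent_lists M n"
    and "\<And>i. i < n \<Longrightarrow> homogeneous_of (e i) (f i)" "\<And>i. i < n \<Longrightarrow> homogeneous_of (e i) (g i)"
  shows "homogeneous_of (M * (\<Sum>i<n. e i)) (chain_monomial M f g ks)"
  using assms
proof (induction n arbitrary: ks)
  case (Suc n)
  obtain k ks' where ks: "ks = k # ks'" "k \<le> M" "ks' \<in> exponent_lists M n"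
    using Suc.prems(1) by (cases ks) auto
  have IH: "homogeneous_of (M * (\<Sum>i<n. e i)) (chain_monomial M f g ks')"
    by (rule Suc.IH[OF ks(3)]) (simp_all add: Suc.prems(2,3))
  have "homogeneous_of (k * e n + (M - k) * e n + M * (\<Sum>i<n. e i))
      (f n ^ k * g n ^ (M - k) * chain_monomial M f g ks')"
    by (intro homogeneous_of_mult homogeneous_of_power IH Suc.prems(2,3)) simp_all
  moreover have "k * e n + (M - k) * e n + M * (\<Sum>i<n. e i) = M * (\<Sum>i<Suc n. e i)"
    using ks(2) by (simp add: distrib_left flip: add_mult_distrib)
  ultimately show ?case
    using ks(1,3) by simp
qed (simp add: homogeneous_of_one)

text \<open>Grouped by the exponent of the last form, a relation on the top set of the chain is a
  polynomial in that form. Its coefficients are combinations of the monomials for the shorter chain: if one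
  vanishes on \<open>Z n\<close>, it is zero by induction, which is what the cancellation step asks for.\<close>

lemma chain_monomials_independent:
  assumes "irreducible_chain zariski n Z"
    and "\<And>i. i < n \<Longrightarrow> homogeneous_of (e i) (f i)" "\<And>i. i < n \<Longrightarrow> homogeneous_of (e i) (g i)"
    and "\<And>i. i < n \<Longrightarrow> vanishes_on (f i) (Z i)" "\<And>i. i < n \<Longrightarrow> \<not> vanishes_on (f i) (Z (Suc i))"
    and "\<And>i. i < n \<Longrightarrow> \<not> vanishes_on (g i) (Z 0)"
    and "vanishes_on (\<Sum>ks\<in>exponent_lists M n. const_mpoly (c ks) * chain_monomial M f g ks) (Z n)"
    and "ks \<in> exponent_lists M n"
  shows "c ks = 0"
  using assms
proof (induction n arbitrary: c ks)
  case 0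
  have "Z 0 \<noteq> {}"
    using 0(1) by (simp add: irreducible_chain_def irreducible_closedin_def)
  moreover have "exponent_lists M 0 = {[]}"
    by auto
  ultimately show ?case
    using 0(7,8) by (auto simp: mpoly_eval_mult)
next
  case (Suc n)
  define h where
    "h k = (\<Sum>ks\<in>exponent_lists M n. const_mpoly (c (k # ks)) * chain_monomial M f g ks)" for k
  have chain: "irreducible_chain zariski n Z"
    and Zn: "irreducible_closedin zariski (Z n)" "irreducible_closedin zariski (Z (Suc n))"
      "Z n \<subseteq> Z (Suc n)" "Z 0 \<subseteq> Z n"
    using Suc.prems(1) irreducible_chain_mono[of zariski n Z 0]
    by (auto simp: irreducible_chain_def)
  have coeff: "c (k # ks) = 0" if "ks \<in> exponent_lists M n" "vanishes_on (h k) (Z n)" for k ks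
  proof (rule Suc.IH[of "\<lambda>ks. c (k # ks)" ks])
    show "vanishes_on (\<Sum>ks\<in>exponent_lists M n. const_mpoly (c (k # ks)) * chain_monomial M f g ks) (Z n)"
      using that(2) unfolding h_def .
    fix i assume "i < n"
    then have "i < Suc n"
      by simp
    note prems = Suc.prems(2-6)[OF this]
    show "homogeneous_of (e i) (f i)" "homogeneous_of (e i) (g i)" "vanishes_on (f i) (Z i)"
      "\<not> vanishes_on (f i) (Z (Suc i))" "\<not> vanishes_on (g i) (Z 0)"
      by (fact prems)+
  qed (fact chain that(1))+
  have hom: "homogeneous_of (M * (\<Sum>i<n. e i)) (h k)" for k
    unfolding h_def
    by (intro homogeneous_of_sum homogeneous_of_const_mult homogeneous_chain_monomial Suc.prems(2,3))
      simp_all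
  have "(\<Sum>ks\<in>exponent_lists M (Suc n). const_mpoly (c ks) * chain_monomial M f g ks)
      = (\<Sum>k\<le>M. f n ^ k * g n ^ (M - k) * h k)"
    unfolding sum_exponent_lists_Suc h_def sum_distrib_left
    by (intro sum.cong refl) (simp add: algebra_simps)
  then have sum: "vanishes_on (\<Sum>k\<le>M. f n ^ k * g n ^ (M - k) * h k) (Z (Suc n))"
    using Suc.prems(7) by simp
  have zero: "h k = 0" if "vanishes_on (h k) (Z n)" for k
    unfolding h_def using coeff[OF _ that] by (intro sum.neutral) simp
  obtain k ks' where ks: "ks = k # ks'" "k \<le> M" "ks' \<in> exponent_lists M n"
    using Suc.prems(8) by (cases ks) auto
  have "vanishes_on (h k) (Z n)"
  proof (rule pencil_coefficients_vanish[OF Zn(1,2,3) _ _ _ _ _ hom _ sum ks(2)])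
    show "homogeneous_of (e n) (f n)" "vanishes_on (f n) (Z n)" "\<not> vanishes_on (f n) (Z (Suc n))"
      "homogeneous_of (e n) (g n)"
      using Suc.prems(2-5)[of n] by simp_all
    show "\<not> vanishes_on (g n) (Z n)"
      using Suc.prems(6)[of n] Zn(4) by blast
    show "vanishes_on (h k) (Z (Suc n))" if "vanishes_on (h k) (Z n)" for k
      by (simp add: zero[OF that])
  qed
  then show ?case
    using coeff ks(1,3) by blast
qed

text \<open>The counting argument: \<open>L p u\<close> are linear functionals that detect, for \<open>u\<close> in the set \<open>U D\<close>, whether a form
  of degree \<open>D\<close> vanishes on the top of the chain. The \<open>(M + 1) ^ n\<close> independent monomials of
  degree \<open>M * E\<close> cannot outnumber these functionals, and for large \<open>M\<close> this forces \<open>n \<le> r\<close>.\<close>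

lemma irreducible_chain_length_le:
  fixes Z :: "nat \<Rightarrow> 'n::finite proj set" and L :: "'n mpoly \<Rightarrow> 'u \<Rightarrow> complex"
  assumes chain: "irreducible_chain zariski n Z"
    and U: "\<And>D. finite (U D)" "\<And>D. card (U D) \<le> (D + 1) ^ r"
    and lin: "\<And>p q u. L (p + q) u = L p u + L q u" "\<And>c p u. L (const_mpoly c * p) u = c * L p u"
    and van: "\<And>D p. homogeneous_of D p \<Longrightarrow> \<forall>u\<in>U D. L p u = 0 \<Longrightarrow> vanishes_on p (Z n)"
  shows "n \<le> r"
proof (rule ccontr)
  assume "\<not> n \<le> r"
  then have nr: "Suc r \<le> n"
    by simp
  have "\<exists>d f. homogeneous_of d f \<and> vanishes_on f (Z i) \<and> \<not> vanishes_on f (Z (Suc i))" if "i < n" for i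
  proof -
    have "Z i \<subset> Z (Suc i)" "closedin zariski (Z i)"
      using chain that by (auto simp: irreducible_chain_def irreducible_closedin_def)
    then obtain P where "P \<in> Z (Suc i)" "P \<notin> zariski closure_of Z i"
      by (auto simp: closure_of_closedin)
    then show ?thesis
      unfolding zariski_closure_iff by blast
  qed
  then obtain e f where f: "\<And>i. i < n \<Longrightarrow> homogeneous_of (e i) (f i)"
    "\<And>i. i < n \<Longrightarrow> vanishes_on (f i) (Z i)" "\<And>i. i < n \<Longrightarrow> \<not> vanishes_on (f i) (Z (Suc i))"
    by metis
  have "Z 0 \<noteq> {}"
    using chain by (simp add: irreducible_chain_def irreducible_closedin_def)
  then obtain P where P: "P \<in> Z 0"
    by blast
  obtain s where s: "rep_proj P $ s \<noteq> 0"
    using rep_proj_nonzero[of P] by (auto simp: vec_eq_iff)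
  define g where "g i = var_mpoly s ^ e i" for i
  have g: "homogeneous_of (e i) (g i)" "\<not> vanishes_on (g i) (Z 0)" for i
    using homogeneous_of_power[OF homogeneous_of_var[of s], of "e i"] P s
    by (auto simp: g_def mpoly_eval_power)
  define E where "E = (\<Sum>i<n. e i)"
  \<comment> \<open>With this choice \<open>(M + 1) ^ Suc r\<close> exceeds \<open>((M + 1) * (E + 1)) ^ r\<close>.\<close>
  define M where "M = (E + 1) ^ r"
  have fin: "finite (exponent_lists M n)"
    by (rule finite_lists_length_eq) simp
  have card: "card (exponent_lists M n) = (M + 1) ^ n"
    by (subst card_lists_length_eq) simp_all
  have "(M * E + 1) ^ r \<le> ((M + 1) * (E + 1)) ^ r"
    by (intro power_mono) (simp_all add: algebra_simps)
  also have "\<dots> = (M + 1) ^ r * M"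
    unfolding power_mult_distrib by (simp only: M_def)
  also have "\<dots> < (M + 1) ^ Suc r"
    by simp
  also have "\<dots> \<le> (M + 1) ^ n"
    using nr by (intro power_increasing) simp_all
  finally have "card (U (M * E)) < card (exponent_lists M n)"
    using U(2)[of "M * E"] card by linarith
  then obtain c where c: "\<exists>ks\<in>exponent_lists M n. c ks \<noteq> 0"
    "\<forall>u\<in>U (M * E). (\<Sum>ks\<in>exponent_lists M n. c ks * L (chain_monomial M f g ks) u) = 0"
    using underdetermined_system[OF U(1) fin, of "M * E" "\<lambda>ks. L (chain_monomial M f g ks)"] by blast
  define p where "p = (\<Sum>ks\<in>exponent_lists M n. const_mpoly (c ks) * chain_monomial M f g ks)"
  have L0: "L 0 u = 0" for u
    using lin(1)[of 0 0 u] by simp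
  have "L (sum F A) u = (\<Sum>x\<in>A. L (F x) u)" for F :: "nat list \<Rightarrow> _" and A u
    by (induction A rule: infinite_finite_induct) (simp_all add: lin(1) L0)
  then have "\<forall>u\<in>U (M * E). L p u = 0"
    using c(2) by (simp add: p_def lin(2))
  moreover have "homogeneous_of (M * E) p"
    unfolding p_def E_def
    by (intro homogeneous_of_sum homogeneous_of_const_mult homogeneous_chain_monomial f(1) g(1))
  ultimately have "vanishes_on p (Z n)"
    using van by blast
  then have "\<forall>ks\<in>exponent_lists M n. c ks = 0"
    using chain_monomials_independent[OF chain f(1) g(1) f(2,3) g(2)] unfolding p_def by blast
  then show False
    using c(1) by blast
qed

section \<open>Closures of images of squarefree monomial maps\<close>

definition monomial_map :: "('p::finite \<Rightarrow> 'c::finite \<Rightarrow> bool) \<Rightarrow> complex ^ 'p \<Rightarrow> complex ^ 'c" where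
  "monomial_map inc x = (\<chi> c. \<Prod>v | inc v c. x $ v)"

text \<open>Polynomial functions in many variables are only used through their restrictions to lines, which
  are polynomials in one variable and so have finitely many zeros or vanish.\<close>

definition polynomial_on_lines :: "(complex ^ 'p::finite \<Rightarrow> complex) \<Rightarrow> bool" where
  "polynomial_on_lines f \<longleftrightarrow> (\<forall>a b. \<exists>P. \<forall>s. f (a + s *s b) = poly P s)"

lemma polynomial_on_lines_const: "polynomial_on_lines (\<lambda>_. c)"
  unfolding polynomial_on_lines_def by (intro allI exI[of _ "[:c:]"]) simp

lemma polynomial_on_lines_coordinate: "polynomial_on_lines (\<lambda>x. x $ v)"
  unfolding polynomial_on_lines_def
proof (intro allI exI)
  fix a b :: "complex ^ 'a" and s
  show "(a + s *s b) $ v = poly [:a $ v, b $ v:] s"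
    by simp
qed

lemma polynomial_on_lines_add:
  assumes "polynomial_on_lines f" "polynomial_on_lines g"
  shows "polynomial_on_lines (\<lambda>x. f x + g x)"
  unfolding polynomial_on_lines_def
proof (intro allI)
  fix a b
  obtain P Q where "\<forall>s. f (a + s *s b) = poly P s" "\<forall>s. g (a + s *s b) = poly Q s"
    using assms unfolding polynomial_on_lines_def by metis
  then show "\<exists>R. \<forall>s. f (a + s *s b) + g (a + s *s b) = poly R s"
    by (intro exI[of _ "P + Q"]) simp
qed

lemma polynomial_on_lines_mult:
  assumes "polynomial_on_lines f" "polynomial_on_lines g"
  shows "polynomial_on_lines (\<lambda>x. f x * g x)"
  unfolding polynomial_on_lines_def
proof (intro allI)
  fix a b
  obtain P Q where "\<forall>s. f (a + s *s b) = poly P s" "\<forall>s. g (a + s *s b) = poly Q s"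
    using assms unfolding polynomial_on_lines_def by metis
  then show "\<exists>R. \<forall>s. f (a + s *s b) * g (a + s *s b) = poly R s"
    by (intro exI[of _ "P * Q"]) simp
qed

lemma polynomial_on_lines_sum:
  "(\<And>i. i \<in> I \<Longrightarrow> polynomial_on_lines (f i)) \<Longrightarrow> polynomial_on_lines (\<lambda>x. \<Sum>i\<in>I. f i x)"
  by (induction I rule: infinite_finite_induct)
    (simp_all add: polynomial_on_lines_const polynomial_on_lines_add)

lemma polynomial_on_lines_prod:
  "(\<And>i. i \<in> I \<Longrightarrow> polynomial_on_lines (f i)) \<Longrightarrow> polynomial_on_lines (\<lambda>x. \<Prod>i\<in>I. f i x)"
  by (induction I rule: infinite_finite_induct)
    (simp_all add: polynomial_on_lines_const polynomial_on_lines_mult)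

lemma polynomial_on_lines_power:
  "polynomial_on_lines f \<Longrightarrow> polynomial_on_lines (\<lambda>x. f x ^ n)"
  by (induction n) (simp_all add: polynomial_on_lines_const polynomial_on_lines_mult)

lemma polynomial_on_lines_mpoly_eval:
  "polynomial_on_lines (\<lambda>x. mpoly_eval p (monomial_map inc x))"
  unfolding mpoly_eval_def monom_eval_def monomial_map_def vec_lambda_beta
  by (intro polynomial_on_lines_sum polynomial_on_lines_mult polynomial_on_lines_const
      polynomial_on_lines_prod polynomial_on_lines_power polynomial_on_lines_coordinate)

definition slice :: "'p set \<Rightarrow> 'p set \<Rightarrow> (complex ^ 'p::finite) set" where
  "slice K J = {x. (\<forall>v\<in>K. x $ v = 0) \<and> (\<forall>v\<in>J. x $ v = 1)}"

text \<open>A slice is an affine subspace, and the stratum is the open torus in it. The parameters in \<open>K\<close> are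
  set to 0, those in \<open>J\<close> to 1, and all others are free.\<close>

definition stratum :: "'p set \<Rightarrow> 'p set \<Rightarrow> (complex ^ 'p::finite) set" where
  "stratum K J = {x \<in> slice K J. \<forall>v. v \<notin> K \<longrightarrow> x $ v \<noteq> 0}"

text \<open>If neither function vanishes identically, take a line in the slice through a point where the first
  one does not vanish and a point where the second one does not: the product of the two
  restrictions would be the zero polynomial.\<close>

lemma slice_zero_product:
  assumes f: "polynomial_on_lines f" and g: "polynomial_on_lines g"
    and fg: "\<And>x. x \<in> slice K J \<Longrightarrow> f x * g x = 0"
  shows "(\<forall>x\<in>slice K J. f x = 0) \<or> (\<forall>x\<in>slice K J. g x = 0)"
proof (rule ccontr)
  assume "\<not> ?thesis"
  then obtain x y where x: "x \<in> slice K J" "f x \<noteq> 0" and y: "y \<in> slice K J" "g y \<noteq> 0"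
    by blast
  obtain P where P: "\<And>s. f (x + s *s (y - x)) = poly P s"
    using f unfolding polynomial_on_lines_def by blast
  obtain Q where Q: "\<And>s. g (x + s *s (y - x)) = poly Q s"
    using g unfolding polynomial_on_lines_def by blast
  have "x + s *s (y - x) \<in> slice K J" for s
    using x(1) y(1) by (simp add: slice_def)
  then have "poly (P * Q) s = 0" for s
    using fg P Q by (metis poly_mult)
  then have "P * Q = 0"
    using poly_all_0_iff_0 by blast
  moreover have "poly P 0 \<noteq> 0" "poly Q 1 \<noteq> 0"
    using x(2) y(2) by (simp_all flip: P Q)
  ultimately show False
    by auto
qed

lemma unit_point_in_stratum:
  "K \<inter> J = {} \<Longrightarrow> (\<chi> v. if v \<in> K then 0 else 1) \<in> stratum K J"
  by (auto simp: stratum_def slice_def)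

text \<open>The stratum is dense in the slice: the product \<open>h\<close> of the coordinates outside \<open>K\<close> vanishes on the
  rest of the slice, so \<open>f * h\<close> vanishes everywhere, while \<open>h\<close> does not.\<close>

lemma vanishes_stratum_imp_slice:
  assumes "K \<inter> J = {}" "polynomial_on_lines f" "\<And>x. x \<in> stratum K J \<Longrightarrow> f x = 0" "x \<in> slice K J"
  shows "f x = 0"
proof -
  define h where "h x = (\<Prod>v\<in>-K. x $ v)" for x :: "complex ^ 'a"
  have "polynomial_on_lines h"
    unfolding h_def by (intro polynomial_on_lines_prod polynomial_on_lines_coordinate)
  moreover have "f x * h x = 0" if "x \<in> slice K J" for x
    using that assms(3)[of x] by (auto simp: stratum_def h_def)
  moreover have "h (\<chi> v. if v \<in> K then 0 else 1) \<noteq> 0" "(\<chi> v. if v \<in> K then 0 else 1) \<in> slice K J"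
    using unit_point_in_stratum[OF assms(1)] by (simp_all add: h_def stratum_def)
  ultimately show ?thesis
    using slice_zero_product[OF assms(2), of h K J] assms(4) by blast
qed

lemma stratum_zero_product:
  assumes "K \<inter> J = {}" "polynomial_on_lines f" "polynomial_on_lines g"
    "\<And>x. x \<in> stratum K J \<Longrightarrow> f x * g x = 0"
  shows "(\<forall>x\<in>stratum K J. f x = 0) \<or> (\<forall>x\<in>stratum K J. g x = 0)"
proof -
  have "f x * g x = 0" if "x \<in> slice K J" for x
    using vanishes_stratum_imp_slice[OF assms(1) polynomial_on_lines_mult[OF assms(2,3)] assms(4) that] .
  then have "(\<forall>x\<in>slice K J. f x = 0) \<or> (\<forall>x\<in>slice K J. g x = 0)"
    by (rule slice_zero_product[OF assms(2,3)])
  then show ?thesis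
    by (auto simp: stratum_def)
qed

definition toric :: "('p::finite \<Rightarrow> 'c::finite \<Rightarrow> bool) \<Rightarrow> 'p set \<Rightarrow> 'p set \<Rightarrow> 'c proj set" where
  "toric inc K J = zariski closure_of ((\<lambda>x. abs_proj (monomial_map inc x)) ` stratum K J)"

lemma monomial_map_eq_0_iff: "monomial_map inc x $ c = 0 \<longleftrightarrow> (\<exists>v. inc v c \<and> x $ v = 0)"
  by (auto simp: monomial_map_def)

text \<open>If every monomial involves a parameter in \<open>K\<close>, the monomial map is zero on the stratum and has no
  value in projective space.\<close>

definition avoidable :: "('p \<Rightarrow> 'c \<Rightarrow> bool) \<Rightarrow> 'p set \<Rightarrow> bool" where
  "avoidable inc K \<longleftrightarrow> (\<exists>c. \<forall>v\<in>K. \<not> inc v c)"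

lemma monomial_map_nonzero:
  assumes "x \<in> stratum K J" "avoidable inc K"
  shows "monomial_map inc x \<noteq> 0"
proof -
  obtain c where "\<forall>v\<in>K. \<not> inc v c"
    using assms(2) unfolding avoidable_def by blast
  then have "monomial_map inc x $ c \<noteq> 0"
    using assms(1) by (auto simp: monomial_map_eq_0_iff stratum_def)
  then show ?thesis
    by auto
qed

lemma vanishes_on_closure_iff:
  assumes "homogeneous_of d p"
  shows "vanishes_on p (zariski closure_of Y) \<longleftrightarrow> vanishes_on p Y"
proof -
  have "Y \<subseteq> zariski closure_of Y"
    by (simp add: closure_of_subset)
  moreover have "mpoly_eval p (rep_proj P) = 0" if "vanishes_on p Y" "P \<in> zariski closure_of Y" for P
    using that assms unfolding zariski_closure_iff by blast
  ultimately show ?thesis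
    by blast
qed

lemma vanishes_on_stratum_image_iff:
  assumes "homogeneous_of d p" "avoidable inc K"
  shows "vanishes_on p ((\<lambda>x. abs_proj (monomial_map inc x)) ` stratum K J) \<longleftrightarrow>
    (\<forall>x\<in>stratum K J. mpoly_eval p (monomial_map inc x) = 0)"
  using mpoly_eval_rep_abs_eq_0_iff[OF assms(1) monomial_map_nonzero[OF _ assms(2)]] by auto

lemma vanishes_on_toric_iff:
  assumes "homogeneous_of d p" "avoidable inc K"
  shows "vanishes_on p (toric inc K J) \<longleftrightarrow>
    (\<forall>x\<in>stratum K J. mpoly_eval p (monomial_map inc x) = 0)"
  unfolding toric_def vanishes_on_closure_iff[OF assms(1)]
  by (rule vanishes_on_stratum_image_iff[OF assms])

lemma closedin_toric: "closedin zariski (toric inc K J)"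
  by (simp add: toric_def)

lemma irreducible_toric:
  assumes "K \<inter> J = {}" "avoidable inc K"
  shows "irreducible_closedin zariski (toric inc K J)"
  unfolding toric_def
proof (rule irreducible_zariski_closure)
  show "(\<lambda>x. abs_proj (monomial_map inc x)) ` stratum K J \<noteq> {}"
    using unit_point_in_stratum[OF assms(1)] by blast
  fix d e and p q :: "'b mpoly"
  assume hom: "homogeneous_of d p" "homogeneous_of e q"
  show "vanishes_on p ((\<lambda>x. abs_proj (monomial_map inc x)) ` stratum K J) \<or>
    vanishes_on q ((\<lambda>x. abs_proj (monomial_map inc x)) ` stratum K J)"
    if "vanishes_on (p * q) ((\<lambda>x. abs_proj (monomial_map inc x)) ` stratum K J)"
  proof -
    have "\<forall>x\<in>stratum K J. mpoly_eval (p * q) (monomial_map inc x) = 0"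
      using that vanishes_on_stratum_image_iff[OF homogeneous_of_mult[OF hom] assms(2)] by blast
    then have "(\<forall>x\<in>stratum K J. mpoly_eval p (monomial_map inc x) = 0) \<or>
        (\<forall>x\<in>stratum K J. mpoly_eval q (monomial_map inc x) = 0)"
      by (intro stratum_zero_product assms(1) polynomial_on_lines_mpoly_eval) (simp add: mpoly_eval_mult)
    then show ?thesis
      using vanishes_on_stratum_image_iff[OF hom(1) assms(2)]
        vanishes_on_stratum_image_iff[OF hom(2) assms(2)] by blast
  qed
qed

lemma toric_mono: "J' \<subseteq> J \<Longrightarrow> toric inc K J \<subseteq> toric inc K J'"
  unfolding toric_def by (intro closure_of_mono image_mono) (auto simp: stratum_def slice_def)

section \<open>A lower bound for the dimension\<close>

text \<open>In terms of the incidence matrix: among the columns that are zero on \<open>K\<close>, there are for each \<open>i\<close> two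
  that agree in the first \<open>i\<close> rows of the list and differ in the next one. The differences of the two
  columns form a triangular system.\<close>

definition separating :: "('p \<Rightarrow> 'c \<Rightarrow> bool) \<Rightarrow> 'p set \<Rightarrow> 'p list \<Rightarrow> bool" where
  "separating inc K bs \<longleftrightarrow> (\<forall>i<length bs. \<exists>c c'.
     (\<forall>v\<in>K. \<not> inc v c \<and> \<not> inc v c') \<and>
     (\<forall>j<i. inc (bs ! j) c \<longleftrightarrow> inc (bs ! j) c') \<and> inc (bs ! i) c \<and> \<not> inc (bs ! i) c')"

text \<open>The value of a monomial at the point with the coordinate of \<open>v\<close> equal to 2, those in \<open>K\<close> equal to 0
  and all others equal to 1.\<close>

lemma prod_pair_at_two:
  fixes v :: "'p::finite"
  shows "(\<Prod>w | inc w c. if w \<in> K then 0 else if w = v then 2 else (1 :: complex)) =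
    (if \<exists>w\<in>K. inc w c then 0 else if inc v c then 2 else 1)"
proof (cases "\<exists>w\<in>K. inc w c")
  case False
  then have "(\<Prod>w | inc w c. if w \<in> K then 0 else if w = v then 2 else (1 :: complex)) =
      (\<Prod>w | inc w c. if w = v then 2 else 1)"
    by (intro prod.cong) auto
  then show ?thesis
    using False by (simp add: prod.delta)
qed auto

text \<open>The chain frees the parameters of the list one at a time. At stage \<open>i\<close> the two coordinates
  for \<open>c\<close> and \<open>c'\<close> are equal as functions of the free parameters; once \<open>bs ! i\<close> is free, they differ at
  the point where it is 2.\<close>

lemma zariski_dim_toric_ge:
  assumes sep: "separating inc K bs" and c0: "avoidable inc K"
  shows "enat (length bs) \<le> zariski_dim (toric inc K {})"
  unfolding zariski_dim_def
proof (rule krull_dim_ge)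
  define J where "J i = - K - set (take i bs)" for i
  have "irreducible_chain zariski (length bs) (\<lambda>i. toric inc K (J i))"
    unfolding irreducible_chain_def
  proof (intro conjI allI impI)
    show "irreducible_closedin zariski (toric inc K (J i))" for i
      by (rule irreducible_toric[OF _ c0]) (auto simp: J_def)
    fix i assume i: "i < length bs"
    obtain c c' where K: "\<forall>v\<in>K. \<not> inc v c \<and> \<not> inc v c'"
      and agree: "\<And>j. j < i \<Longrightarrow> inc (bs ! j) c \<longleftrightarrow> inc (bs ! j) c'"
      and differ: "inc (bs ! i) c" "\<not> inc (bs ! i) c'"
      using sep i unfolding separating_def by blast
    have agree': "inc b c \<longleftrightarrow> inc b c'" if "b \<in> set (take i bs)" for b
      using that agree i by (auto simp: in_set_conv_nth)
    define p where "p = var_mpoly c + const_mpoly (-1) * var_mpoly c'"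
    have p: "mpoly_eval p y = y $ c - y $ c'" for y
      by (simp add: p_def mpoly_eval_add mpoly_eval_mult)
    have hom: "homogeneous_of 1 p"
      unfolding p_def by (intro homogeneous_of_add homogeneous_of_const_mult homogeneous_of_var)
    have "vanishes_on p (toric inc K (J i))"
      unfolding vanishes_on_toric_iff[OF hom c0]
    proof
      fix x :: "complex ^ 'a" assume x: "x \<in> stratum K (J i)"
      have "(\<Prod>v | inc v d. x $ v) = (\<Prod>v | inc v d \<and> v \<in> set (take i bs). x $ v)"
        if "d = c \<or> d = c'" for d
      proof (rule prod.mono_neutral_right)
        show "\<forall>v\<in>{v. inc v d} - {v. inc v d \<and> v \<in> set (take i bs)}. x $ v = 1"
          using x K that by (auto simp: stratum_def slice_def J_def)
      qed auto
      moreover have "{v. inc v c \<and> v \<in> set (take i bs)} = {v. inc v c' \<and> v \<in> set (take i bs)}"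
        using agree' by blast
      ultimately show "mpoly_eval p (monomial_map inc x) = 0"
        by (simp add: p monomial_map_def)
    qed
    moreover have "\<not> vanishes_on p (toric inc K (J (Suc i)))"
      unfolding vanishes_on_toric_iff[OF hom c0]
    proof
      define x :: "complex ^ 'a" where "x = (\<chi> w. if w \<in> K then 0 else if w = bs ! i then 2 else 1)"
      have "x \<in> stratum K (J (Suc i))"
        using i by (auto simp: x_def stratum_def slice_def J_def take_Suc_conv_app_nth)
      moreover have "mpoly_eval p (monomial_map inc x) = 1"
        using K differ by (auto simp: p monomial_map_def x_def prod_pair_at_two)
      moreover assume "\<forall>x\<in>stratum K (J (Suc i)). mpoly_eval p (monomial_map inc x) = 0"
      ultimately show False
        by auto
    qed
    moreover have "toric inc K (J i) \<subseteq> toric inc K (J (Suc i))"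
      by (rule toric_mono) (use set_take_subset_set_take[of i "Suc i" bs] in \<open>auto simp: J_def\<close>)
    ultimately show "toric inc K (J i) \<subset> toric inc K (J (Suc i))"
      by blast
  qed
  moreover have "toric inc K (J (length bs)) \<subseteq> toric inc K {}"
    by (rule toric_mono) simp
  ultimately show "irreducible_chain (subtopology zariski (toric inc K {})) (length bs) (\<lambda>i. toric inc K (J i))"
    by (simp add: irreducible_chain_subtopology_iff[OF closedin_toric])
qed

section \<open>An upper bound for the dimension\<close>

definition affinely_determined_by :: "('p \<Rightarrow> 'c \<Rightarrow> bool) \<Rightarrow> 'p set \<Rightarrow> bool" where
  "affinely_determined_by inc B \<longleftrightarrow> (\<forall>v. \<exists>(r0 :: real) r. \<forall>c.
     of_bool (inc v c) = r0 + (\<Sum>b\<in>B. r b * of_bool (inc b c)))"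

text \<open>The exponent vector, as a monomial in the parameters, of the pullback of a monomial in the
  coordinates of the target space.\<close>

definition weight :: "('p \<Rightarrow> 'c \<Rightarrow> bool) \<Rightarrow> ('c::finite \<Rightarrow>\<^sub>0 nat) \<Rightarrow> 'p \<Rightarrow> nat" where
  "weight inc \<alpha> v = (\<Sum>c | inc v c. Poly_Mapping.lookup \<alpha> c)"

lemma monom_eval_monomial_map:
  "monom_eval \<alpha> (monomial_map inc x) = (\<Prod>v\<in>UNIV. (x $ v) ^ weight inc \<alpha> v)"
proof -
  have "monom_eval \<alpha> (monomial_map inc x) =
      (\<Prod>c\<in>UNIV. \<Prod>v\<in>UNIV. if inc v c then (x $ v) ^ Poly_Mapping.lookup \<alpha> c else 1)"
    by (simp add: monom_eval_def monomial_map_def prod_power_distrib prod.If_cases)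
  also have "\<dots> = (\<Prod>v\<in>UNIV. \<Prod>c\<in>UNIV. if inc v c then (x $ v) ^ Poly_Mapping.lookup \<alpha> c else 1)"
    by (rule prod.swap)
  also have "\<dots> = (\<Prod>v\<in>UNIV. (x $ v) ^ weight inc \<alpha> v)"
    by (simp add: weight_def power_sum prod.If_cases)
  finally show ?thesis .
qed

text \<open>The affine relation between the rows is summed over the columns with multiplicities \<open>\<alpha>\<close>; the
  constant term is multiplied by the degree.\<close>

lemma weight_determined:
  assumes det: "affinely_determined_by inc B"
    and deg: "(\<Sum>c\<in>UNIV. Poly_Mapping.lookup \<alpha> c) = (\<Sum>c\<in>UNIV. Poly_Mapping.lookup \<beta> c)"
    and eq: "\<And>b. b \<in> B \<Longrightarrow> weight inc \<alpha> b = weight inc \<beta> b"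
  shows "weight inc \<alpha> = weight inc \<beta>"
proof
  fix v
  obtain r0 :: real and r where r: "\<And>c. of_bool (inc v c) = r0 + (\<Sum>b\<in>B. r b * of_bool (inc b c))"
    using det unfolding affinely_determined_by_def by blast
  have w: "real (weight inc \<gamma> u) = (\<Sum>c\<in>UNIV. real (Poly_Mapping.lookup \<gamma> c) * of_bool (inc u c))" for \<gamma> u
    by (simp add: weight_def of_bool_def if_distrib sum.If_cases)
  have "real (weight inc \<gamma> v) = real (\<Sum>c\<in>UNIV. Poly_Mapping.lookup \<gamma> c) * r0
      + (\<Sum>b\<in>B. r b * real (weight inc \<gamma> b))" for \<gamma>
  proof -
    have "real (weight inc \<gamma> v) = (\<Sum>c\<in>UNIV. real (Poly_Mapping.lookup \<gamma> c) * r0)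
        + (\<Sum>c\<in>UNIV. \<Sum>b\<in>B. r b * (real (Poly_Mapping.lookup \<gamma> c) * of_bool (inc b c)))"
      by (simp only: w r distrib_left sum_distrib_left sum.distrib mult.left_commute)
    also have "(\<Sum>c\<in>UNIV. \<Sum>b\<in>B. r b * (real (Poly_Mapping.lookup \<gamma> c) * of_bool (inc b c)))
        = (\<Sum>b\<in>B. r b * real (weight inc \<gamma> b))"
      by (subst sum.swap) (simp only: w sum_distrib_left)
    finally show ?thesis
      by (simp add: sum_distrib_right)
  qed
  then have "real (weight inc \<alpha> v) = real (weight inc \<beta> v)"
    using deg eq by (simp del: of_nat_sum)
  then show "weight inc \<alpha> v = weight inc \<beta> v"
    by simp
qed

text \<open>The pullback of a form of degree \<open>D\<close> vanishes if its coefficient at each weight in \<open>U D\<close> is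
  zero. A weight is determined by its entries at \<open>B\<close>, each of which lies between 0 and \<open>D\<close>.\<close>

lemma zariski_dim_toric_le:
  fixes inc :: "'p::finite \<Rightarrow> 'c::finite \<Rightarrow> bool"
  assumes det: "affinely_determined_by inc B"
  shows "zariski_dim (toric inc {} {}) \<le> enat (card B)"
  unfolding zariski_dim_def
proof (rule krull_dim_le)
  fix Z n assume "irreducible_chain (subtopology zariski (toric inc {} {})) n Z"
  then have chain: "irreducible_chain zariski n Z" and Zn: "Z n \<subseteq> toric inc {} {}"
    by (simp_all add: irreducible_chain_subtopology_iff[OF closedin_toric])
  define deg :: "('c \<Rightarrow>\<^sub>0 nat) \<Rightarrow> nat" where "deg \<alpha> = (\<Sum>c\<in>UNIV. Poly_Mapping.lookup \<alpha> c)" for \<alpha>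
  define U where "U D = weight inc ` {\<alpha>. deg \<alpha> = D}" for D
  define L where "L p u = (\<Sum>\<alpha> | \<alpha> \<in> Poly_Mapping.keys p \<and> weight inc \<alpha> = u. Poly_Mapping.lookup p \<alpha>)"
    for p :: "'c mpoly" and u
  have L_superset: "L p u = (\<Sum>\<alpha> | \<alpha> \<in> A \<and> weight inc \<alpha> = u. Poly_Mapping.lookup p \<alpha>)"
    if "finite A" "Poly_Mapping.keys p \<subseteq> A" for p u A
    unfolding L_def
    by (rule sum.mono_neutral_left) (use that in \<open>auto simp: in_keys_iff\<close>)
  show "n \<le> card B"
  proof (rule irreducible_chain_length_le[OF chain, of U "card B" L])
    have inj: "inj_on (\<lambda>u. restrict u B) (U D)" for D
    proof (rule inj_onI)
      fix u w assume u: "u \<in> U D" and w: "w \<in> U D" and eq: "restrict u B = restrict w B"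
      obtain \<alpha> where \<alpha>: "u = weight inc \<alpha>" "deg \<alpha> = D"
        using u by (auto simp: U_def)
      obtain \<beta> where \<beta>: "w = weight inc \<beta>" "deg \<beta> = D"
        using w by (auto simp: U_def)
      have "weight inc \<alpha> b = weight inc \<beta> b" if "b \<in> B" for b
        using fun_cong[OF eq, of b] that by (simp add: \<alpha>(1) \<beta>(1))
      then show "u = w"
        using weight_determined[OF det, of \<alpha> \<beta>] \<alpha> \<beta> by (simp add: deg_def)
    qed
    have sub: "(\<lambda>u. restrict u B) ` U D \<subseteq> (\<Pi>\<^sub>E b\<in>B. {..D})" for D
    proof -
      have "weight inc \<alpha> b \<le> deg \<alpha>" for \<alpha> b
        unfolding weight_def deg_def by (rule sum_mono2) auto
      then show ?thesis
        by (auto simp: U_def)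
    qed
    have finE: "finite (\<Pi>\<^sub>E b\<in>B. {..D})" for D :: nat
      by (intro finite_PiE) auto
    show "finite (U D)" for D
      using finite_imageD[OF finite_subset[OF sub finE] inj] .
    show "card (U D) \<le> (D + 1) ^ card B" for D
      using card_inj_on_le[OF inj sub finE, of D] by (simp add: card_PiE)
    show "L (p + q) u = L p u + L q u" for p q u
    proof -
      let ?A = "Poly_Mapping.keys p \<union> Poly_Mapping.keys q"
      have "L (p + q) u = (\<Sum>\<alpha> | \<alpha> \<in> ?A \<and> weight inc \<alpha> = u. Poly_Mapping.lookup (p + q) \<alpha>)"
        by (rule L_superset) (simp_all add: keys_add)
      also have "\<dots> = L p u + L q u"
        by (simp add: lookup_add sum.distrib L_superset[of ?A p] L_superset[of ?A q])
      finally show ?thesis .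
    qed
    show "L (const_mpoly c * p) u = c * L p u" for c p u
    proof -
      have "const_mpoly c * p = Poly_Mapping.map ((*) c) p"
        by (simp add: mult_map_scale_conv_mult)
      then have "Poly_Mapping.lookup (const_mpoly c * p) \<alpha> = c * Poly_Mapping.lookup p \<alpha>" for \<alpha>
        by (simp add: Poly_Mapping.map.rep_eq when_def)
      moreover from this have "Poly_Mapping.keys (const_mpoly c * p) \<subseteq> Poly_Mapping.keys p"
        by (auto simp: in_keys_iff)
      ultimately show ?thesis
        using L_superset[of "Poly_Mapping.keys p" "const_mpoly c * p"] by (simp add: sum_distrib_left L_def)
    qed
    fix D p assume hom: "homogeneous_of D p" and L0: "\<forall>u\<in>U D. L p u = 0"
    have "mpoly_eval p (monomial_map inc x) = 0" for x
    proof -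
      have "mpoly_eval p (monomial_map inc x) =
          (\<Sum>\<alpha>\<in>Poly_Mapping.keys p. Poly_Mapping.lookup p \<alpha> * (\<Prod>v\<in>UNIV. (x $ v) ^ weight inc \<alpha> v))"
        by (simp add: mpoly_eval_def monom_eval_monomial_map)
      also have "\<dots> = (\<Sum>u\<in>weight inc ` Poly_Mapping.keys p.
          \<Sum>\<alpha> | \<alpha> \<in> Poly_Mapping.keys p \<and> weight inc \<alpha> = u.
            Poly_Mapping.lookup p \<alpha> * (\<Prod>v\<in>UNIV. (x $ v) ^ weight inc \<alpha> v))"
        by (rule sum.image_gen) simp
      also have "\<dots> = (\<Sum>u\<in>weight inc ` Poly_Mapping.keys p. L p u * (\<Prod>v\<in>UNIV. (x $ v) ^ u v))"
        by (simp add: L_def sum_distrib_right)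
      also have "\<dots> = 0"
      proof (rule sum.neutral, rule ballI)
        fix u assume "u \<in> weight inc ` Poly_Mapping.keys p"
        then have "u \<in> U D"
          using hom by (auto simp: U_def deg_def homogeneous_of_def)
        then show "L p u * (\<Prod>v\<in>UNIV. (x $ v) ^ u v) = 0"
          using L0 by simp
      qed
      finally show ?thesis .
    qed
    then have "vanishes_on p (toric inc {} {})"
      using vanishes_on_toric_iff[OF hom, where inc = inc and K = "{}" and J = "{}"] by (simp add: avoidable_def)
    then show "vanishes_on p (Z n)"
      using Zn by blast
  qed
qed

section \<open>Facets of 0/1 polytopes\<close>

definition incidence_vector :: "('p::finite \<Rightarrow> 'c \<Rightarrow> bool) \<Rightarrow> 'c \<Rightarrow> real ^ 'p" where
  "incidence_vector inc c = (\<chi> v. of_bool (inc v c))"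

lemma triangular_independent:
  fixes d :: "nat \<Rightarrow> real ^ 'p::finite"
  assumes nz: "\<And>i. i < n \<Longrightarrow> d i $ b i \<noteq> 0" and z: "\<And>i j. j < i \<Longrightarrow> i < n \<Longrightarrow> d i $ b j = 0"
    and "m \<le> n"
  shows "independent (d ` {m..<n}) \<and> inj_on d {m..<n}"
  using \<open>m \<le> n\<close>
proof (induction rule: inc_induct)
  case base
  then show ?case
    by (simp add: independent_empty)
next
  case (step m)
  have "d ` {Suc m..<n} \<subseteq> {x. x $ b m = 0}"
  proof
    fix x assume "x \<in> d ` {Suc m..<n}"
    then obtain i where "x = d i" "m < i" "i < n"
      by auto
    then show "x \<in> {x. x $ b m = 0}"
      using z by simp
  qed
  moreover have "subspace {x :: real ^ 'p. x $ b m = 0}"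
    by (simp add: subspace_def)
  ultimately have "span (d ` {Suc m..<n}) \<subseteq> {x. x $ b m = 0}"
    by (rule span_minimal)
  then have notin: "d m \<notin> span (d ` {Suc m..<n})"
    using nz[OF step.hyps(2)] by auto
  have new: "d m \<notin> d ` {Suc m..<n}"
    using notin span_superset[of "d ` {Suc m..<n}"] by (rule contra_subsetD[rotated])
  have ind: "independent (insert (d m) (d ` {Suc m..<n}))"
    by (rule independent_insertI[OF notin conjunct1[OF step.IH]])
  have ins: "{m..<n} = insert m {Suc m..<n}"
    using step.hyps(2) by auto
  have "inj_on d (insert m {Suc m..<n})"
    unfolding inj_on_insert using step.IH new by blast
  then show ?case
    unfolding ins image_insert using ind by (rule conjI[rotated])
qed

text \<open>The differences of the pairs of vertices given by a separating list are independent because they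
  are triangular with respect to the coordinates in the list.\<close>

lemma aff_dim_incidence_vectors_ge:
  assumes sep: "separating inc K bs" and K: "avoidable inc K"
  shows "int (length bs) \<le> aff_dim {incidence_vector inc c | c. \<forall>v\<in>K. \<not> inc v c}" (is "_ \<le> aff_dim ?S")
proof -
  obtain c0 where c0: "\<forall>v\<in>K. \<not> inc v c0"
    using K unfolding avoidable_def by blast
  define a where "a = incidence_vector inc c0"
  have a: "a \<in> ?S"
    using c0 a_def by blast
  define Q where "Q i c c' \<longleftrightarrow> (\<forall>v\<in>K. \<not> inc v c \<and> \<not> inc v c') \<and>
     (\<forall>j<i. inc (bs ! j) c \<longleftrightarrow> inc (bs ! j) c') \<and> inc (bs ! i) c \<and> \<not> inc (bs ! i) c'" for i c c'
  have "\<forall>i<length bs. \<exists>c c'. Q i c c'"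
    using sep unfolding separating_def Q_def .
  then obtain c c' where Q: "\<And>i. i < length bs \<Longrightarrow> Q i (c i) (c' i)"
    by metis
  define d where "d i = incidence_vector inc (c i) - incidence_vector inc (c' i)" for i
  let ?V = "(\<lambda>x. - a + x) ` ?S"
  have "independent (d ` {0..<length bs}) \<and> inj_on d {0..<length bs}"
    by (rule triangular_independent[where b = "\<lambda>i. bs ! i"])
      (use Q in \<open>simp_all add: d_def incidence_vector_def Q_def\<close>)
  note ind = this
  have "d i \<in> span ?V" if "i < length bs" for i
  proof -
    have "incidence_vector inc (c i) \<in> ?S" "incidence_vector inc (c' i) \<in> ?S"
      using Q[OF that] unfolding Q_def by blast+
    then have "- a + incidence_vector inc (c i) \<in> span ?V" "- a + incidence_vector inc (c' i) \<in> span ?V"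
      by (simp_all only: span_base imageI)
    then have "(- a + incidence_vector inc (c i)) - (- a + incidence_vector inc (c' i)) \<in> span ?V"
      by (rule span_diff)
    then show ?thesis
      by (simp add: d_def)
  qed
  then have "d ` {0..<length bs} \<subseteq> span ?V"
    by auto
  then have "card (d ` {0..<length bs}) \<le> dim (span ?V)"
    using ind by (intro independent_card_le_dim) blast+
  moreover have "card (d ` {0..<length bs}) = length bs"
    using ind by (simp add: card_image)
  moreover have "aff_dim ?S = int (dim ?V)"
    by (rule aff_dim_eq_dim[OF hull_inc[OF a]])
  ultimately show ?thesis
    by (simp add: dim_span)
qed

lemma aff_dim_incidence_vectors_le:
  fixes inc :: "'p::finite \<Rightarrow> 'c \<Rightarrow> bool"
  assumes det: "affinely_determined_by inc B"
  shows "aff_dim (range (incidence_vector inc)) \<le> int (card B)"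
proof -
  obtain r0 :: "'p \<Rightarrow> real" and r where
    r: "\<And>v c. of_bool (inc v c) = r0 v + (\<Sum>b\<in>B. r v b * of_bool (inc b c))"
    using det unfolding affinely_determined_by_def by metis
  define w where "w b = (\<chi> v. r v b)" for b
  fix c0 :: 'c
  let ?a = "incidence_vector inc c0"
  have "- ?a + incidence_vector inc c \<in> span (w ` B)" for c
  proof -
    have "- ?a + incidence_vector inc c = (\<Sum>b\<in>B. (of_bool (inc b c) - of_bool (inc b c0)) *\<^sub>R w b)"
    proof (rule vec_eq_iff[THEN iffD2], rule allI)
      fix v
      have "(- ?a + incidence_vector inc c) $ v = of_bool (inc v c) - of_bool (inc v c0)"
        by (simp add: incidence_vector_def)
      also have "\<dots> = (\<Sum>b\<in>B. r v b * of_bool (inc b c)) - (\<Sum>b\<in>B. r v b * of_bool (inc b c0))"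
        by (simp only: r[of v])
      also have "\<dots> = (\<Sum>b\<in>B. r v b * (of_bool (inc b c) - of_bool (inc b c0)))"
        by (simp only: sum_subtractf right_diff_distrib)
      also have "\<dots> = (\<Sum>b\<in>B. (of_bool (inc b c) - of_bool (inc b c0)) *\<^sub>R w b) $ v"
        by (simp add: w_def mult.commute)
      finally show "(- ?a + incidence_vector inc c) $ v =
        (\<Sum>b\<in>B. (of_bool (inc b c) - of_bool (inc b c0)) *\<^sub>R w b) $ v" .
    qed
    then show ?thesis
      by (simp add: span_sum span_scale span_base)
  qed
  then have "dim ((\<lambda>x. - ?a + x) ` range (incidence_vector inc)) \<le> card (w ` B)"
    by (intro dim_le_card) auto
  also have "\<dots> \<le> card B"
    by (rule card_image_le) simp
  finally show ?thesis
    by (subst aff_dim_eq_dim[of ?a]) (simp_all add: hull_inc)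
qed

text \<open>The hyperplane supports the polytope since all coordinates are nonnegative, and the face is proper
  since some vertex lies off it. The bounds on the two dimensions leave room for a difference of 1
  only.\<close>

lemma facet_of_coordinate_hyperplane:
  fixes inc :: "'p::finite \<Rightarrow> 'c \<Rightarrow> bool"
  defines "P \<equiv> convex hull (range (incidence_vector inc))"
  assumes det: "affinely_determined_by inc B" and sep: "separating inc {v} bs"
    and card: "card B \<le> Suc (length bs)" and av: "avoidable inc {v}" and c: "inc v c"
  shows "{a \<in> P. a $ v = 0} facet_of P"
proof -
  let ?F = "{a \<in> P. a $ v = 0}"
  have nonneg: "0 \<le> a $ v" if "a \<in> P" for a
  proof -
    have "P \<subseteq> {a. 0 \<le> a $ v}"
      unfolding P_def
    proof (rule hull_minimal)
      show "convex {a :: real ^ 'p. 0 \<le> a $ v}"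
        using convex_halfspace_ge[of 0 "axis v 1 :: real ^ 'p"] by (simp add: inner_axis' inner_axis)
    qed (auto simp: incidence_vector_def)
    then show ?thesis
      using that by blast
  qed
  have "P \<inter> {a. axis v 1 \<bullet> a = 0} face_of P"
    by (rule face_of_Int_supporting_hyperplane_ge)
      (use nonneg in \<open>auto simp: P_def inner_axis'\<close>)
  moreover have "P \<inter> {a. axis v 1 \<bullet> a = 0} = ?F"
    by (auto simp: inner_axis')
  ultimately have face: "?F face_of P"
    by simp
  have "{incidence_vector inc c | c. \<forall>u\<in>{v}. \<not> inc u c} \<subseteq> ?F"
    by (auto simp: P_def incidence_vector_def intro: hull_inc)
  then have ge: "int (length bs) \<le> aff_dim ?F"
    using aff_dim_incidence_vectors_ge[OF sep av] aff_dim_subset order_trans by blast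
  have "incidence_vector inc c \<in> P" "incidence_vector inc c \<notin> ?F"
    using c by (auto simp: P_def incidence_vector_def intro: hull_inc)
  then have "aff_dim ?F < aff_dim P"
    using face by (intro face_of_aff_dim_lt) (auto simp: P_def)
  moreover have "aff_dim P \<le> int (card B)"
    using aff_dim_incidence_vectors_le[OF det] by (simp add: P_def aff_dim_convex_hull)
  ultimately have "aff_dim ?F = aff_dim P - 1"
    using ge card by linarith
  moreover have "?F \<noteq> {}"
  proof
    assume "?F = {}"
    then have "aff_dim ?F = -1"
      by (simp only: aff_dim_empty_eq)
    then show False
      using ge by simp
  qed
  ultimately show ?thesis
    using face by (simp add: facet_of_def)
qed

section \<open>Images of coordinate slices\<close>

lemma zariski_closure_eqI:
  assumes "\<And>d p. homogeneous_of d p \<Longrightarrow> vanishes_on p Y \<longleftrightarrow> vanishes_on p Y'"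
  shows "zariski closure_of Y = zariski closure_of Y'"
proof (rule set_eqI)
  fix P
  show "P \<in> zariski closure_of Y \<longleftrightarrow> P \<in> zariski closure_of Y'"
    unfolding zariski_closure_iff using assms by blast
qed

lemma monomial_map_scale:
  assumes "\<And>c. card {v. inc v c} = k"
  shows "monomial_map inc (a *s x) = a ^ k *s monomial_map inc x"
  by (simp add: vec_eq_iff monomial_map_def prod.distrib assms)

text \<open>Points of the domain with further vanishing coordinates do not enlarge the closure, because a
  polynomial that vanishes on the stratum vanishes on the slice. All monomials having the same
  degree \<open>k\<close>, the chosen representatives of projective points do not matter; as \<open>k\<close> is positive, the
  zero vector is outside the domain.\<close>

lemma toric_eq_closure_slice:
  fixes inc :: "'p::finite \<Rightarrow> 'c::finite \<Rightarrow> bool"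
  assumes k: "\<And>c. card {v. inc v c} = k" "0 < k" and av: "avoidable inc K"
  shows "zariski closure_of ((\<lambda>P. abs_proj (monomial_map inc (rep_proj P))) `
      {P. monomial_map inc (rep_proj P) \<noteq> 0 \<and> (\<forall>v\<in>K. rep_proj P $ v = 0)}) = toric inc K {}"
    (is "zariski closure_of (?m ` ?D) = _")
  unfolding toric_def
proof (rule zariski_closure_eqI)
  fix d and p :: "'c mpoly" assume hom: "homogeneous_of d p"
  have "vanishes_on p (?m ` ?D) \<longleftrightarrow> (\<forall>P\<in>?D. mpoly_eval p (monomial_map inc (rep_proj P)) = 0)"
    using mpoly_eval_rep_abs_eq_0_iff[OF hom] by auto
  also have "\<dots> \<longleftrightarrow> (\<forall>x\<in>stratum K {}. mpoly_eval p (monomial_map inc x) = 0)"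
  proof
    assume van: "\<forall>P\<in>?D. mpoly_eval p (monomial_map inc (rep_proj P)) = 0"
    show "\<forall>x\<in>stratum K {}. mpoly_eval p (monomial_map inc x) = 0"
    proof
      fix x assume x: "x \<in> stratum K {}"
      have m: "monomial_map inc x \<noteq> 0"
        by (rule monomial_map_nonzero[OF x av])
      have "monomial_map inc (0 *s x) = 0"
        using k(2) by (simp only: monomial_map_scale[OF k(1)]) (simp add: vec_eq_iff)
      then have "x \<noteq> 0"
        using m by auto
      then obtain a where a: "a \<noteq> 0" "rep_proj (abs_proj x) = a *s x"
        by (rule rep_abs_proj)
      have "a ^ k *s monomial_map inc x \<noteq> 0"
        using a(1) m by (simp add: vec_eq_iff)
      then have "monomial_map inc (rep_proj (abs_proj x)) \<noteq> 0"
        by (simp only: a(2) monomial_map_scale[OF k(1)] not_False_eq_True)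
      moreover have "\<forall>v\<in>K. rep_proj (abs_proj x) $ v = 0"
        using x by (simp add: a(2) stratum_def slice_def)
      ultimately have "mpoly_eval p (monomial_map inc (rep_proj (abs_proj x))) = 0"
        using van by simp
      then have "mpoly_eval p (monomial_map inc (a *s x)) = 0"
        by (simp only: a(2))
      then show "mpoly_eval p (monomial_map inc x) = 0"
        using a(1) by (simp add: monomial_map_scale[OF k(1)] mpoly_eval_scale[OF hom])
    qed
  next
    assume van: "\<forall>x\<in>stratum K {}. mpoly_eval p (monomial_map inc x) = 0"
    have "mpoly_eval p (monomial_map inc x) = 0" if "x \<in> slice K {}" for x
      by (rule vanishes_stratum_imp_slice[OF _ polynomial_on_lines_mpoly_eval])
        (use van that in auto)
    then show "\<forall>P\<in>?D. mpoly_eval p (monomial_map inc (rep_proj P)) = 0"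
      by (simp add: slice_def)
  qed
  also have "\<dots> \<longleftrightarrow> vanishes_on p ((\<lambda>x. abs_proj (monomial_map inc x)) ` stratum K {})"
    by (rule vanishes_on_stratum_image_iff[OF hom av, symmetric])
  finally show "vanishes_on p (?m ` ?D) \<longleftrightarrow>
    vanishes_on p ((\<lambda>x. abs_proj (monomial_map inc x)) ` stratum K {})" .
qed


text \<open>The coordinate of a configuration through \<open>v\<close> vanishes on the closure for \<open>{v}\<close>. If the configuration
  avoids \<open>w\<close>, this coordinate is 1 at a point of the closure for \<open>{w}\<close>.\<close>

lemma toric_singleton_neq:
  assumes "inc v c" "\<not> inc w c" "avoidable inc {v}"
  shows "toric inc {v} {} \<noteq> toric inc {w} {}"
proof
  assume eq: "toric inc {v} {} = toric inc {w} {}"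
  have w: "avoidable inc {w}"
    using assms(2) by (auto simp: avoidable_def)
  have "\<forall>x\<in>stratum {v} {}. mpoly_eval (var_mpoly c) (monomial_map inc x) = 0"
    using assms(1) by (auto simp: monomial_map_eq_0_iff stratum_def slice_def)
  then have "vanishes_on (var_mpoly c) (toric inc {v} {})"
    using vanishes_on_toric_iff[OF homogeneous_of_var assms(3)] by blast
  then have "\<forall>x\<in>stratum {w} {}. mpoly_eval (var_mpoly c) (monomial_map inc x) = 0"
    using vanishes_on_toric_iff[OF homogeneous_of_var w] unfolding eq by blast
  then have "mpoly_eval (var_mpoly c) (monomial_map inc (\<chi> u. if u \<in> {w} then 0 else 1)) = 0"
    using unit_point_in_stratum[of "{w}" "{}"] by blast
  then show False
    using assms(2) by (auto simp: monomial_map_eq_0_iff split: if_splits)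
qed

lemma toric_singleton_psubset:
  assumes "inc v c" "avoidable inc {v}" "toric inc {v} {} \<subseteq> toric inc {} {}"
  shows "toric inc {v} {} \<subset> toric inc {} {}"
proof -
  have "\<forall>x\<in>stratum {v} {}. mpoly_eval (var_mpoly c) (monomial_map inc x) = 0"
    using assms(1) by (auto simp: monomial_map_eq_0_iff stratum_def slice_def)
  then have "vanishes_on (var_mpoly c) (toric inc {v} {})"
    using vanishes_on_toric_iff[OF homogeneous_of_var assms(2)] by blast
  moreover have "\<not> vanishes_on (var_mpoly c) (toric inc {} {})"
  proof
    assume "vanishes_on (var_mpoly c) (toric inc {} {})"
    then have "\<forall>x\<in>stratum {} {}. mpoly_eval (var_mpoly c) (monomial_map inc x) = 0"
      using vanishes_on_toric_iff[OF homogeneous_of_var, of inc "{}"] by (simp add: avoidable_def)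
    then show False
      using unit_point_in_stratum[of "{}" "{}"] by (auto simp: monomial_map_eq_0_iff)
  qed
  ultimately show ?thesis
    using assms(3) by blast
qed

section \<open>The torus action\<close>

definition scale_mpoly :: "complex ^ 'n \<Rightarrow> 'n::finite mpoly \<Rightarrow> 'n mpoly" where
  "scale_mpoly s p =
    (\<Sum>a\<in>Poly_Mapping.keys p. Poly_Mapping.single a (Poly_Mapping.lookup p a * monom_eval a s))"

lemma mpoly_eval_scale_mpoly: "mpoly_eval (scale_mpoly s p) y = mpoly_eval p (s * y)"
  by (simp add: scale_mpoly_def mpoly_eval_sum mpoly_eval_single mpoly_eval_def[of p] monom_eval_def
      power_mult_distrib prod.distrib mult.assoc)

lemma homogeneous_of_scale_mpoly: "homogeneous_of d p \<Longrightarrow> homogeneous_of d (scale_mpoly s p)"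
  unfolding scale_mpoly_def
  by (rule homogeneous_of_sum) (auto simp: homogeneous_of_def split: if_splits)

lemma goepel_monomials_eq: "goepel_monomials = monomial_map in_config"
  by (simp add: fun_eq_iff goepel_monomials_def monomial_map_def)

lemma monomial_map_mult: "monomial_map inc (x * y) = monomial_map inc x * monomial_map inc y"
  by (simp add: monomial_map_def vec_eq_iff prod.distrib)

lemma torus_act_eq: "torus_act t P = abs_proj (monomial_map in_config t * rep_proj P)"
  unfolding torus_act_def goepel_monomials_eq by (rule arg_cong[of _ _ abs_proj]) (simp add: vec_eq_iff)

lemma monomial_map_torus_nonzero: "t \<in> torus \<Longrightarrow> monomial_map in_config t $ c \<noteq> 0"
  by (simp add: monomial_map_eq_0_iff torus_def)

lemma torus_mult_nonzero:
  assumes "t \<in> torus" "y \<noteq> 0"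
  shows "monomial_map in_config t * y \<noteq> 0"
  using assms monomial_map_torus_nonzero[OF assms(1)] by (auto simp: vec_eq_iff)

lemma torus_act_abs_proj:
  assumes "t \<in> torus" "y \<noteq> 0"
  shows "torus_act t (abs_proj y) = abs_proj (monomial_map in_config t * y)"
proof -
  obtain a where a: "a \<noteq> 0" "rep_proj (abs_proj y) = a *s y"
    using rep_abs_proj[OF assms(2)] .
  have "torus_act t (abs_proj y) = abs_proj (a *s (monomial_map in_config t * y))"
    unfolding torus_act_eq a(2) by (rule arg_cong[of _ _ abs_proj]) (simp add: vec_eq_iff)
  then show ?thesis
    using abs_proj_scale[OF torus_mult_nonzero[OF assms] a(1)] by simp
qed

lemma torus_act_mult:
  assumes "s \<in> torus" "t \<in> torus"
  shows "torus_act s (torus_act t P) = torus_act (s * t) P"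
  using torus_act_abs_proj[OF assms(1) torus_mult_nonzero[OF assms(2) rep_proj_nonzero]]
  by (simp add: torus_act_eq monomial_map_mult mult.assoc)

lemma torus_act_one: "torus_act 1 P = P"
  by (simp add: torus_act_eq monomial_map_def abs_rep_proj flip: one_vec_def)

text \<open>The action is diagonal, and its pullback maps forms that vanish on the image of the stratum to such
  forms, since the stratum is closed under multiplication by the torus.\<close>

lemma torus_act_toric_subset:
  assumes t: "t \<in> torus" and av: "avoidable in_config K" and P: "P \<in> toric in_config K {}"
  shows "torus_act t P \<in> toric in_config K {}"
  unfolding toric_def zariski_closure_iff
proof (intro allI impI)
  fix d and p :: "goepel_config mpoly"
  assume hom: "homogeneous_of d p"
  assume "vanishes_on p ((\<lambda>x. abs_proj (monomial_map in_config x)) ` stratum K {})"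
  then have van: "\<forall>x\<in>stratum K {}. mpoly_eval p (monomial_map in_config x) = 0"
    using vanishes_on_stratum_image_iff[OF hom av] by blast
  let ?s = "monomial_map in_config t"
  have "\<forall>x\<in>stratum K {}. mpoly_eval (scale_mpoly ?s p) (monomial_map in_config x) = 0"
  proof
    fix x assume "x \<in> stratum K {}"
    then have "t * x \<in> stratum K {}"
      using t by (simp add: stratum_def slice_def torus_def)
    then show "mpoly_eval (scale_mpoly ?s p) (monomial_map in_config x) = 0"
      using van by (simp add: mpoly_eval_scale_mpoly flip: monomial_map_mult)
  qed
  then have "vanishes_on (scale_mpoly ?s p) (toric in_config K {})"
    using vanishes_on_toric_iff[OF homogeneous_of_scale_mpoly[OF hom] av] by blast
  then have "mpoly_eval p (?s * rep_proj P) = 0"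
    using P by (simp add: mpoly_eval_scale_mpoly)
  then show "mpoly_eval p (rep_proj (torus_act t P)) = 0"
    unfolding torus_act_eq
    using mpoly_eval_rep_abs_eq_0_iff[OF hom torus_mult_nonzero[OF t rep_proj_nonzero]] by simp
qed

lemma torus_act_image_toric:
  assumes t: "t \<in> torus" and av: "avoidable in_config K"
  shows "torus_act t ` toric in_config K {} = toric in_config K {}"
proof
  show "torus_act t ` toric in_config K {} \<subseteq> toric in_config K {}"
    using torus_act_toric_subset[OF t av] by blast
  define u where "u = (\<chi> v. inverse (t $ v))"
  have u: "u \<in> torus" "t * u = 1"
    using t by (simp_all add: u_def torus_def vec_eq_iff)
  show "toric in_config K {} \<subseteq> torus_act t ` toric in_config K {}"
  proof
    fix P assume "P \<in> toric in_config K {}"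
    then have "torus_act u P \<in> toric in_config K {}"
      by (rule torus_act_toric_subset[OF u(1) av])
    moreover have "P = torus_act t (torus_act u P)"
      by (simp add: torus_act_mult[OF t u(1)] u(2) torus_act_one)
    ultimately show "P \<in> torus_act t ` toric in_config K {}"
      by (rule rev_image_eqI)
  qed
qed

lemma exponent_vec_in_coordinate_face: "exponent_vec c \<in> coordinate_face v \<longleftrightarrow> \<not> in_config v c"
proof -
  have "exponent_vec c \<in> goepel_polytope"
    unfolding goepel_polytope_def by (rule hull_inc) simp
  then show ?thesis
    by (simp add: coordinate_face_def exponent_vec_def)
qed

text \<open>The distinguished point has coordinate 0 exactly at the configurations through \<open>v\<close>. Acting on it by
  \<open>t\<close> gives the image of \<open>t\<close> with the coordinate of \<open>v\<close> replaced by 0.\<close>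

lemma boundary_divisor_eq:
  assumes av: "avoidable in_config {v}"
  shows "boundary_divisor v = toric in_config {v} {}"
proof -
  define y :: "complex ^ goepel_config" where "y = (\<chi> c. if in_config v c then 0 else 1)"
  have y: "y \<noteq> 0" "distinguished_point (coordinate_face v) = abs_proj y"
    using av by (auto simp: y_def avoidable_def vec_eq_iff distinguished_point_def
        exponent_vec_in_coordinate_face if_distrib intro!: arg_cong[of _ _ abs_proj])
  have mult: "monomial_map in_config t * y = monomial_map in_config (\<chi> u. if u = v then 0 else t $ u)" for t
  proof (rule vec_eq_iff[THEN iffD2], rule allI)
    fix c
    show "(monomial_map in_config t * y) $ c =
      monomial_map in_config (\<chi> u. if u = v then 0 else t $ u) $ c"
    proof (cases "in_config v c")
      case True
      then have "monomial_map in_config (\<chi> u. if u = v then 0 else t $ u) $ c = 0"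
        by (auto simp: monomial_map_eq_0_iff)
      then show ?thesis
        using True by (simp add: y_def)
    next
      case False
      then show ?thesis
        by (auto simp: y_def monomial_map_def intro!: prod.cong)
    qed
  qed
  have "(\<lambda>t. torus_act t (abs_proj y)) ` torus =
      (\<lambda>x. abs_proj (monomial_map in_config x)) ` stratum {v} {}" (is "?A = ?B")
  proof
    show "?A \<subseteq> ?B"
    proof
      fix P assume "P \<in> ?A"
      then obtain t where t: "t \<in> torus" "P = torus_act t (abs_proj y)"
        by blast
      have "(\<chi> u. if u = v then 0 else t $ u) \<in> stratum {v} {}"
        using t(1) by (simp add: stratum_def slice_def torus_def)
      moreover have "P = abs_proj (monomial_map in_config (\<chi> u. if u = v then 0 else t $ u))"
        by (simp only: t(2) torus_act_abs_proj[OF t(1) y(1)] mult)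
      ultimately show "P \<in> ?B"
        by (rule rev_image_eqI)
    qed
    show "?B \<subseteq> ?A"
    proof
      fix P assume "P \<in> ?B"
      then obtain x where x: "x \<in> stratum {v} {}" "P = abs_proj (monomial_map in_config x)"
        by blast
      define t where "t = (\<chi> u. if u = v then 1 else x $ u)"
      have t: "t \<in> torus"
        using x(1) by (simp add: t_def torus_def stratum_def)
      have "(\<chi> u. if u = v then 0 else t $ u) = x"
        using x(1) by (simp add: t_def vec_eq_iff stratum_def slice_def)
      then have "P = torus_act t (abs_proj y)"
        by (simp only: x(2) torus_act_abs_proj[OF t y(1)] mult)
      then show "P \<in> ?A"
        using t by blast
    qed
  qed
  then show ?thesis
    unfolding boundary_divisor_def face_subvariety_def toric_def y(2) by simp
qed

section \<open>Enumerating the configurations\<close>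

function pairings :: "nat list \<Rightarrow> nat list list" where
  "pairings [] = [[]]"
| "pairings (x # xs) = concat (map (\<lambda>y. map (\<lambda>ps. x # y # ps) (pairings (remove1 y xs))) xs)"
  by pat_completeness auto
termination
  by (relation "Wellfounded.measure length") (simp_all add: length_remove1 less_Suc_eq_le)

text \<open>A parameter \<open>S\<close> is encoded by the number \<open>set_encode S\<close>, the sum of \<open>2 ^ i\<close> over its elements \<open>i\<close>, and a
  configuration by the increasing list of the codes of its members. So the point \<open>i\<close> is represented by
  its weight \<open>2 ^ i\<close>, and a relabelling of the points by a permutation of the seven weights.\<close>

definition weights :: "nat list" where
  "weights = [2, 4, 8, 16, 32, 64, 128]"

text \<open>A Pascal configuration is determined by a point \<open>z\<close> and a partition of the other six into pairs.\<close>

definition pascal_relabellings :: "nat list list" where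
  "pascal_relabellings = concat (map (\<lambda>z. map (\<lambda>ps. ps @ [z]) (pairings (remove1 z weights))) weights)"

text \<open>The relabelling can be normalised by the group of the Fano plane, which acts regularly on triples of
  non-collinear points: the points 1 and 2 keep their labels, \<open>k\<close> is the third point on their line, and
  \<open>m\<close>, the least of the remaining points, is the image of the point 3.\<close>

definition fano_relabellings :: "nat list list" where
  "fano_relabellings = concat (map (\<lambda>k. case remove1 k [8, 16, 32, 64, 128] of m # ts \<Rightarrow>
     concat (map (\<lambda>p. concat (map (\<lambda>q. map (\<lambda>r. [2, 4, m, k, p, q, r])
       (remove1 q (remove1 p ts))) (remove1 p ts))) ts)) [8, 16, 32, 64, 128])"

fun fano_code :: "nat list \<Rightarrow> nat list" where
  "fano_code [a, b, c, d, e, f, g] = sort [a+b+d, b+c+e, c+d+f, d+e+g, a+e+f, b+f+g, a+c+g]"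

fun pascal_code :: "nat list \<Rightarrow> nat list" where
  "pascal_code [a, b, c, d, e, f, g] = sort [a+b, c+d, e+f, g, a+b+g, c+d+g, e+f+g]"

definition config_codes :: "nat list list" where
  "config_codes = map fano_code fano_relabellings @ map pascal_code pascal_relabellings"

lemmas config_codes_explicit =
  config_codes_def[unfolded fano_relabellings_def pascal_relabellings_def weights_def, simplified]

lemma length_config_codes: "length config_codes = 135"
  by (simp add: config_codes_explicit)

lemma distinct_config_codes: "distinct config_codes"
  by (simp add: config_codes_explicit)

lemma config_codes_wellformed:
  "L \<in> set config_codes \<Longrightarrow> sorted L \<and> distinct L \<and> length L = 7"
proof -
  have "list_all (\<lambda>L. sorted L \<and> distinct L \<and> length L = 7) config_codes"
    by (simp add: config_codes_explicit)
  then show "L \<in> set config_codes \<Longrightarrow> sorted L \<and> distinct L \<and> length L = 7"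
    by (simp add: list_all_iff)
qed

text \<open>The effect on codes of exchanging the points \<open>a\<close> and \<open>Suc a\<close>, with \<open>p = 2 ^ a\<close>.\<close>

definition swap_bits :: "nat \<Rightarrow> nat \<Rightarrow> nat" where
  "swap_bits p n = (if odd (n div p) = odd (n div (2 * p)) then n
     else if odd (n div p) then n + p else n - p)"

text \<open>An opaque name for the set, so that the 135 membership facts can serve as rewrite rules.\<close>

definition config_code_set :: "nat list set" where
  "config_code_set = set config_codes"

text \<open>This makes the list exhaustive, since exchanges of neighbouring points generate all permutations.\<close>

lemma config_codes_swap_closed:
  assumes "L \<in> set config_codes" "p \<in> {2, 4, 8, 16, 32, 64}"
  shows "sort (map (swap_bits p) L) \<in> set config_codes"
proof -
  have "list_all (\<lambda>L. L \<in> config_code_set) config_codes"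
    by (simp add: list_all_iff config_code_set_def)
  note mem = this[unfolded config_codes_explicit, simplified]
  have "list_all (\<lambda>L. sort (map (swap_bits 2) L) \<in> config_code_set) config_codes"
    by (simp add: config_codes_explicit swap_bits_def mem)
  moreover have "list_all (\<lambda>L. sort (map (swap_bits 4) L) \<in> config_code_set) config_codes"
    by (simp add: config_codes_explicit swap_bits_def mem)
  moreover have "list_all (\<lambda>L. sort (map (swap_bits 8) L) \<in> config_code_set) config_codes"
    by (simp add: config_codes_explicit swap_bits_def mem)
  moreover have "list_all (\<lambda>L. sort (map (swap_bits 16) L) \<in> config_code_set) config_codes"
    by (simp add: config_codes_explicit swap_bits_def mem)
  moreover have "list_all (\<lambda>L. sort (map (swap_bits 32) L) \<in> config_code_set) config_codes"
    by (simp add: config_codes_explicit swap_bits_def mem)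
  moreover have "list_all (\<lambda>L. sort (map (swap_bits 64) L) \<in> config_code_set) config_codes"
    by (simp add: config_codes_explicit swap_bits_def mem)
  ultimately show ?thesis
    using assms by (auto simp: list_all_iff config_code_set_def)
qed

text \<open>Used in place of conditional expressions below: with plain recursion equations, rewriting
  evaluates the functions in time linear in the length of the lists.\<close>

fun cons_if :: "bool \<Rightarrow> 'a \<Rightarrow> 'a list \<Rightarrow> 'a list" where
  "cons_if True x xs = x # xs"
| "cons_if False x xs = xs"

fun containing :: "nat \<Rightarrow> nat list list \<Rightarrow> nat list list" where
  "containing b [] = []"
| "containing b (L # Ls) = cons_if (list_ex ((=) b) L) L (containing b Ls)"

fun avoiding :: "nat \<Rightarrow> nat list list \<Rightarrow> nat list list" where
  "avoiding b [] = []"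
| "avoiding b (L # Ls) = cons_if (list_all ((\<noteq>) b) L) L (avoiding b Ls)"

fun cons_block :: "'a list \<Rightarrow> 'a list list \<Rightarrow> 'a list list" where
  "cons_block [] Bs = Bs"
| "cons_block [x] Bs = Bs"
| "cons_block (x # y # xs) Bs = (x # y # xs) # Bs"

fun split_blocks :: "nat \<Rightarrow> nat list list list \<Rightarrow> nat list list list" where
  "split_blocks b [] = []"
| "split_blocks b (B # Bs) = 
    cons_block (containing b B) (cons_block (avoiding b B) (split_blocks b Bs))"

text \<open>Partition refinement: the blocks are the classes of codes that agree at the parameters treated so
  far, and the next parameter has to split one of them. Blocks with fewer than two elements can
  be dropped.\<close>

fun separates :: "nat list \<Rightarrow> nat list list list \<Rightarrow> bool" where
  "separates [] Bs = True"
| "separates (b # bs) Bs =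
    (list_ex (\<lambda>B. list_ex (\<lambda>L. list_ex ((=) b) L) B \<and> list_ex (\<lambda>L. list_all ((\<noteq>) b) L) B) Bs \<and>
     separates bs (split_blocks b Bs))"

lemma set_containing: "set (containing b Ls) = {L \<in> set Ls. b \<in> set L}"
proof (induction Ls)
  case (Cons L Ls)
  have "list_ex ((=) b) L \<longleftrightarrow> b \<in> set L"
    by (auto simp: list_ex_iff)
  with Cons show ?case
    by (cases "b \<in> set L") auto
qed simp

lemma set_avoiding: "set (avoiding b Ls) = {L \<in> set Ls. b \<notin> set L}"
proof (induction Ls)
  case (Cons L Ls)
  have "list_all ((\<noteq>) b) L \<longleftrightarrow> b \<notin> set L"
    by (auto simp: list_all_iff)
  with Cons show ?case
    by (cases "b \<in> set L") auto
qed simp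

lemma set_cons_block: "set (cons_block B Bs) \<subseteq> insert B (set Bs)"
  by (induction B Bs rule: cons_block.induct) auto

lemma set_split_blocks:
  "set (split_blocks b Bs) \<subseteq> containing b ` set Bs \<union> avoiding b ` set Bs"
proof (induction Bs)
  case (Cons B Bs)
  then show ?case
    using set_cons_block[of "containing b B" "cons_block (avoiding b B) (split_blocks b Bs)"]
      set_cons_block[of "avoiding b B" "split_blocks b Bs"] by auto
qed simp

lemma separatesD:
  assumes "separates bs Bs" "i < length bs"
  shows "\<exists>B\<in>set Bs. \<exists>L\<in>set B. \<exists>M\<in>set B.
    (\<forall>j<i. bs ! j \<in> set L \<longleftrightarrow> bs ! j \<in> set M) \<and> bs ! i \<in> set L \<and> bs ! i \<notin> set M"
  using assms
proof (induction bs Bs arbitrary: i rule: separates.induct)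
  case (2 b bs Bs)
  show ?case
  proof (cases i)
    case 0
    obtain B L M where "B \<in> set Bs" "L \<in> set B" "b \<in> set L" "M \<in> set B" "b \<notin> set M"
      using 2(2) by (auto simp: list_ex_iff list_all_iff)
    then show ?thesis
      unfolding 0 by (auto simp only: nth_Cons_0 not_less_zero simp_thms)
  next
    case (Suc j)
    have "separates bs (split_blocks b Bs)" "j < length bs"
      using 2(2,3) Suc by simp_all
    from 2(1)[OF this] obtain B L M where B: "B \<in> set (split_blocks b Bs)" "L \<in> set B" "M \<in> set B"
      and LM: "\<forall>k<j. bs ! k \<in> set L \<longleftrightarrow> bs ! k \<in> set M" "bs ! j \<in> set L" "bs ! j \<notin> set M"
      by (elim bexE conjE)
    obtain B' where B': "B' \<in> set Bs" "B = containing b B' \<or> B = avoiding b B'"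
      using subsetD[OF set_split_blocks B(1)] by (elim UnE imageE) simp_all
    then have L: "L \<in> set B'" and M: "M \<in> set B'" and b: "b \<in> set L \<longleftrightarrow> b \<in> set M"
      using B(2,3) by (auto simp: set_containing set_avoiding)
    have agree: "\<forall>k<Suc j. (b # bs) ! k \<in> set L \<longleftrightarrow> (b # bs) ! k \<in> set M"
      using LM(1) b by (simp add: All_less_Suc2)
    show ?thesis
      unfolding Suc nth_Cons_Suc
      by (rule bexI[OF _ B'(1)], rule bexI[OF _ L], rule bexI[OF _ M]) (intro conjI agree LM(2,3))
  qed
qed simp

text \<open>The codes of the seven points, of the fourteen pairs in \<open>{1..6}\<close> other than 56, and of the fourteen
  triples \<open>abc\<close> with \<open>a < b < c\<close>, \<open>a \<le> 2\<close>, \<open>b \<le> 4\<close> and \<open>c \<le> 6\<close>, each group in lexicographic order.\<close>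

definition separating_codes :: "nat list" where
  "separating_codes = [2, 4, 8, 16, 32, 64, 128,
     6, 10, 18, 34, 66, 12, 20, 36, 68, 24, 40, 72, 48, 80,
     14, 22, 38, 70, 26, 42, 74, 50, 82, 28, 44, 76, 52, 84]"

lemma separates_config_codes_2:
  "separates (remove1 2 separating_codes) [avoiding 2 config_codes]"
  by (simp add: separating_codes_def config_codes_explicit)

lemma separates_config_codes_6:
  "separates (remove1 6 separating_codes) [avoiding 6 config_codes]"
  by (simp add: separating_codes_def config_codes_explicit)

lemma separates_config_codes_22:
  "separates (remove1 22 separating_codes) [avoiding 22 config_codes]"
  by (simp add: separating_codes_def config_codes_explicit)

text \<open>These pairs of configurations meet only in 1, only in 12 and only in 124, respectively; the last one
  is the fifth list together with the fourth.\<close>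

lemma config_codes_meeting_once:
  "list_ex ((=) [2, 12, 14, 48, 50, 192, 194]) config_codes"
  "list_ex ((=) [2, 20, 22, 72, 74, 160, 162]) config_codes"
  "list_ex ((=) [6, 8, 14, 48, 56, 192, 200]) config_codes"
  "list_ex ((=) [6, 16, 22, 72, 88, 160, 176]) config_codes"
  "list_ex ((=) [2, 20, 22, 40, 42, 192, 194]) config_codes"
  by (simp_all add: config_codes_explicit)

section \<open>Codes and configurations\<close>

abbreviation configs :: "nat set set set" where
  "configs \<equiv> fano_configs \<union> pascal_configs"

lemma odd_set_encode_div: "finite S \<Longrightarrow> odd (set_encode S div 2 ^ x) \<longleftrightarrow> x \<in> S"
  using set_encode_inverse[of S] unfolding set_decode_def by blast

lemma set_encode_transpose:
  assumes S: "finite S"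
  shows "set_encode (Transposition.transpose a (Suc a) ` S) = swap_bits (2 ^ a) (set_encode S)"
proof -
  let ?t = "Transposition.transpose a (Suc a)"
  have odd: "odd (set_encode S div 2 ^ a) \<longleftrightarrow> a \<in> S"
    "odd (set_encode S div (2 * 2 ^ a)) \<longleftrightarrow> Suc a \<in> S"
    using odd_set_encode_div[OF S, of a] odd_set_encode_div[OF S, of "Suc a"] by simp_all
  have remove: "set_encode S = 2 ^ x + set_encode (S - {x})" if "x \<in> S" for x
    using that S set_encode_insert[of "S - {x}" x] by (simp add: insert_absorb)
  consider "a \<in> S \<longleftrightarrow> Suc a \<in> S" | "a \<in> S" "Suc a \<notin> S" | "a \<notin> S" "Suc a \<in> S"
    by blast
  then show ?thesis
  proof cases
    case 1
    then have "?t ` S = S"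
      by (auto simp: Transposition.transpose_def image_iff)
    then show ?thesis
      using 1 odd by (simp add: swap_bits_def)
  next
    case 2
    then have "?t ` S = insert (Suc a) (S - {a})"
      by (auto simp: Transposition.transpose_def image_iff)
    then show ?thesis
      using 2 odd S remove[of a] by (simp add: swap_bits_def)
  next
    case 3
    then have "?t ` S = insert a (S - {Suc a})"
      by (auto simp: Transposition.transpose_def image_iff)
    then show ?thesis
      using 3 odd S remove[of "Suc a"] by (simp add: swap_bits_def)
  qed
qed

text \<open>Permutations of the list of weights are the lists of the weights \<open>2 ^ \<sigma> i\<close>. The index shift by one
  comes from lists being numbered from 0 and the points from 1.\<close>

lemma relabelling_permutation:
  assumes "sort xs = weights"
  obtains \<sigma> where "\<sigma> permutes {1..7}" "xs = map (\<lambda>i. 2 ^ \<sigma> i) [1, 2, 3, 4, 5, 6, 7]"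
proof -
  have weights: "weights = map (\<lambda>i. 2 ^ Suc i) [0..<7]"
    by (simp add: weights_def upt_conv_Cons)
  have length: "length weights = 7"
    by (simp add: weights_def)
  have "mset xs = mset weights"
    using arg_cong[OF assms, of mset] by simp
  then obtain p where p: "p permutes {..<length weights}" "permute_list p weights = xs"
    by (rule mset_eq_permutation)
  define \<sigma> where "\<sigma> i = (if i \<in> {1..7} then Suc (p (i - 1)) else i)" for i
  have p7: "p permutes {..<7}"
    using p(1) unfolding length .
  have less: "p i < 7 \<longleftrightarrow> i < 7" "inv p i < 7 \<longleftrightarrow> i < 7" for i
    using permutes_in_image[OF p7, of i] permutes_in_image[OF permutes_inv[OF p7], of i] by simp_all
  have shift: "i - 1 < 7 \<and> Suc (i - 1) = i" if "i \<in> {1..7}" for i :: nat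
    using that by auto
  have "bij_betw \<sigma> {1..7} {1..7}"
  proof (rule bij_betwI[where g = "\<lambda>i. Suc (inv p (i - 1))"])
    show "\<sigma> \<in> {1..7} \<rightarrow> {1..7}"
    proof
      fix i :: nat assume i: "i \<in> {1..7}"
      then show "\<sigma> i \<in> {1..7}"
        using less(1)[of "i - 1"] shift[OF i] by (simp add: \<sigma>_def)
    qed
    show "(\<lambda>i. Suc (inv p (i - 1))) \<in> {1..7} \<rightarrow> {1..7}"
    proof
      fix i :: nat assume i: "i \<in> {1..7}"
      then show "Suc (inv p (i - 1)) \<in> {1..7}"
        using less(2)[of "i - 1"] shift[OF i] by simp
    qed
    show "Suc (inv p (\<sigma> i - 1)) = i" if i: "i \<in> {1..7}" for i
    proof -
      have "inv p (\<sigma> i - 1) = i - 1"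
        using i permutes_inverses(2)[OF p7] by (simp only: \<sigma>_def if_True diff_Suc_1)
      then show ?thesis
        using shift[OF i] by simp
    qed
    show "\<sigma> (Suc (inv p (i - 1))) = i" if i: "i \<in> {1..7}" for i
    proof -
      have "Suc (inv p (i - 1)) \<in> {1..7}"
        using less(2)[of "i - 1"] shift[OF i] by simp
      then have "\<sigma> (Suc (inv p (i - 1))) = Suc (i - 1)"
        using permutes_inverses(1)[OF p7] by (simp only: \<sigma>_def if_True diff_Suc_1)
      then show ?thesis
        using shift[OF i] by simp
    qed
  qed
  then have "\<sigma> permutes {1..7}"
    by (rule bij_imp_permutes) (simp only: \<sigma>_def if_False)
  moreover have "xs = map (\<lambda>i. 2 ^ \<sigma> i) [1, 2, 3, 4, 5, 6, 7]"
  proof (rule nth_equalityI)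
    have "length xs = 7"
      unfolding p(2)[symmetric] length_permute_list by (rule length)
    then show "length xs = length (map (\<lambda>i. 2 ^ \<sigma> i) [1, 2, 3, 4, 5, 6, 7])"
      by simp
    fix i assume "i < length xs"
    then have i: "i < 7"
      by (simp only: \<open>length xs = 7\<close>)
    have "xs ! i = weights ! p i"
      unfolding p(2)[symmetric] by (rule permute_list_nth[OF p(1)]) (simp add: length i)
    also have "\<dots> = 2 ^ Suc (p i)"
      unfolding weights using i less(1)[of i] by simp
    also have "Suc (p i) = \<sigma> (Suc i)"
      using i by (simp add: \<sigma>_def)
    also have "Suc i = [1, 2, 3, 4, 5, 6, 7] ! i"
    proof -
      have "[1, 2, 3, 4, 5, 6, 7] = map Suc [0..<7]"
        by (simp add: upt_conv_Cons)
      then show ?thesis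
        using i by simp
    qed
    also have "2 ^ \<sigma> ([1, 2, 3, 4, 5, 6, 7] ! i) = map (\<lambda>i. 2 ^ \<sigma> i) [1, 2, 3, 4, 5, 6, 7] ! i"
      by (rule nth_map[symmetric]) (use i in simp)
    finally show "xs ! i = map (\<lambda>i. 2 ^ \<sigma> i) [1, 2, 3, 4, 5, 6, 7] ! i" .
  qed
  ultimately show thesis
    by (rule that)
qed

lemma set_fano_code:
  assumes "inj \<sigma>"
  shows "set (fano_code (map (\<lambda>i. 2 ^ \<sigma> i) [1, 2, 3, 4, 5, 6, 7])) = set_encode ` (`) \<sigma> ` fano_base"
proof -
  have "set (fano_code [a, b, c, d, e, f, g]) = {a+b+d, b+c+e, c+d+f, d+e+g, a+e+f, b+f+g, a+c+g}" for a b c d e f g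
    by (simp only: fano_code.simps set_sort list.set)
  then show ?thesis
    using assms by (simp add: fano_base_def inj_eq add.assoc)
qed

lemma set_pascal_code:
  assumes "inj \<sigma>"
  shows "set (pascal_code (map (\<lambda>i. 2 ^ \<sigma> i) [1, 2, 3, 4, 5, 6, 7])) = set_encode ` (`) \<sigma> ` pascal_base"
proof -
  have "set (pascal_code [a, b, c, d, e, f, g]) = {a+b, c+d, e+f, g, a+b+g, c+d+g, e+f+g}" for a b c d e f g
    by (simp only: pascal_code.simps set_sort list.set)
  then show ?thesis
    using assms by (simp add: pascal_base_def inj_eq add.assoc)
qed

lemma relabellings_sort:
  "xs \<in> set fano_relabellings \<Longrightarrow> sort xs = weights"
  "xs \<in> set pascal_relabellings \<Longrightarrow> sort xs = weights"
proof -
  have "list_all (\<lambda>xs. sort xs = weights) fano_relabellings"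
    "list_all (\<lambda>xs. sort xs = weights) pascal_relabellings"
    by (simp_all add: fano_relabellings_def pascal_relabellings_def weights_def)
  then show "xs \<in> set fano_relabellings \<Longrightarrow> sort xs = weights"
    "xs \<in> set pascal_relabellings \<Longrightarrow> sort xs = weights"
    by (simp_all add: list_all_iff)
qed

lemma config_code_is_config:
  assumes "L \<in> set config_codes"
  shows "\<exists>C\<in>configs. set L = set_encode ` C"
proof -
  consider xs where "xs \<in> set fano_relabellings" "L = fano_code xs"
    | xs where "xs \<in> set pascal_relabellings" "L = pascal_code xs"
    using assms by (auto simp: config_codes_def)
  then show ?thesis
  proof cases
    case 1
    obtain \<sigma> where \<sigma>: "\<sigma> permutes {1..7}" "xs = map (\<lambda>i. 2 ^ \<sigma> i) [1, 2, 3, 4, 5, 6, 7]"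
      using relabelling_permutation[OF relabellings_sort(1)[OF 1(1)]] .
    have "set L = set_encode ` (`) \<sigma> ` fano_base"
      unfolding 1(2) \<sigma>(2) by (rule set_fano_code[OF permutes_inj[OF \<sigma>(1)]])
    then show ?thesis
      using \<sigma>(1) unfolding fano_configs_def by blast
  next
    case 2
    obtain \<sigma> where \<sigma>: "\<sigma> permutes {1..7}" "xs = map (\<lambda>i. 2 ^ \<sigma> i) [1, 2, 3, 4, 5, 6, 7]"
      using relabelling_permutation[OF relabellings_sort(2)[OF 2(1)]] .
    have "set L = set_encode ` (`) \<sigma> ` pascal_base"
      unfolding 2(2) \<sigma>(2) by (rule set_pascal_code[OF permutes_inj[OF \<sigma>(1)]])
    then show ?thesis
      using \<sigma>(1) unfolding pascal_configs_def by blast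
  qed
qed

definition coded :: "nat set set \<Rightarrow> bool" where
  "coded C \<longleftrightarrow> (\<forall>S\<in>C. finite S) \<and> (\<exists>L\<in>set config_codes. set L = set_encode ` C)"

lemma coded_transpose_adjacent:
  assumes C: "coded C" and a: "a \<in> {1..6}"
  shows "coded ((`) (Transposition.transpose a (Suc a)) ` C)"
proof -
  let ?t = "Transposition.transpose a (Suc a)"
  obtain L where L: "L \<in> set config_codes" "set L = set_encode ` C" and fin: "\<forall>S\<in>C. finite S"
    using C unfolding coded_def by blast
  have "a = 1 \<or> a = 2 \<or> a = 3 \<or> a = 4 \<or> a = 5 \<or> a = 6"
    using a by auto
  then have "(2::nat) ^ a \<in> {2, 4, 8, 16, 32, 64}"
    by auto
  then have "sort (map (swap_bits (2 ^ a)) L) \<in> set config_codes"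
    by (rule config_codes_swap_closed[OF L(1)])
  moreover have "set (sort (map (swap_bits (2 ^ a)) L)) = set_encode ` (`) ?t ` C"
    using fin by (simp add: L(2) image_image set_encode_transpose cong: image_cong)
  ultimately show ?thesis
    using fin unfolding coded_def by blast
qed

text \<open>Conjugating the exchange of \<open>a\<close> and \<open>b\<close> by that of \<open>b\<close> and \<open>Suc b\<close> gives the exchange of \<open>a\<close>
  and \<open>Suc b\<close>.\<close>

lemma coded_transpose_less:
  assumes "1 \<le> a" "a + Suc d \<le> 7" "coded C"
  shows "coded ((`) (Transposition.transpose a (a + Suc d)) ` C)"
  using assms
proof (induction d arbitrary: C)
  case 0
  then show ?case
    using coded_transpose_adjacent[of C a] by simp
next
  case (Suc d)
  let ?b = "a + Suc d"
  let ?s = "Transposition.transpose ?b (Suc ?b)" and ?t = "Transposition.transpose a ?b"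
  have s: "coded ((`) ?s ` C)" if "coded C" for C
    using coded_transpose_adjacent[OF that, of ?b] Suc.prems by simp
  have "coded ((`) ?s ` (`) ?t ` (`) ?s ` C)"
    using Suc.prems by (intro s Suc.IH) simp_all
  moreover have "Transposition.transpose a (Suc ?b) = ?s \<circ> ?t \<circ> ?s"
    by (auto simp: fun_eq_iff Transposition.transpose_def)
  ultimately show ?case
    by (simp add: image_image image_comp comp_def)
qed

lemma coded_transpose:
  assumes "a \<in> {1..7}" "b \<in> {1..7}" "coded C"
  shows "coded ((`) (Transposition.transpose a b) ` C)"
proof -
  have less: "coded ((`) (Transposition.transpose a b) ` C)" if "a < b" "1 \<le> a" "b \<le> 7" for a b
    using coded_transpose_less[of a "b - Suc a" C] that assms(3) by simp
  consider "a < b" | "b < a" | "a = b"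
    by linarith
  then show ?thesis
  proof cases
    case 1
    then show ?thesis
      using less[of a b] assms by simp
  next
    case 2
    then show ?thesis
      using less[of b a] assms by (simp add: transpose_commute)
  next
    case 3
    then show ?thesis
      using assms by simp
  qed
qed

lemma coded_permutes:
  assumes "\<sigma> permutes {1..7}" "coded C"
  shows "coded ((`) \<sigma> ` C)"
  using assms(1) finite_atLeastAtMost
proof (induction rule: permutes_induct)
  case id
  then show ?case
    using assms(2) by simp
next
  case (swap a b p)
  then have "coded ((`) (Transposition.transpose a b) ` (`) p ` C)"
    by (intro coded_transpose)
  then show ?case
    by (simp add: image_image image_comp comp_def)
qed

lemma coded_base: "coded fano_base" "coded pascal_base"
proof -
  have "list_ex ((=) [22, 44, 88, 98, 138, 176, 196]) config_codes"
    "list_ex ((=) [6, 24, 96, 128, 134, 152, 224]) config_codes"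
    by (simp_all add: config_codes_explicit)
  then have mem: "[22, 44, 88, 98, 138, 176, 196] \<in> set config_codes"
    "[6, 24, 96, 128, 134, 152, 224] \<in> set config_codes"
    by (simp_all add: list_ex_iff)
  have "set_encode ` fano_base = {22, 44, 88, 176, 98, 196, 138}"
    by (simp add: fano_base_def)
  then have fano: "set [22, 44, 88, 98, 138, 176, 196] = set_encode ` fano_base"
    by auto
  have "set_encode ` pascal_base = {6, 24, 96, 128, 134, 152, 224}"
    by (simp add: pascal_base_def)
  then have pascal: "set [6, 24, 96, 128, 134, 152, 224] = set_encode ` pascal_base"
    by simp
  have fin: "\<forall>S\<in>fano_base. finite S" "\<forall>S\<in>pascal_base. finite S"
    by (simp_all add: fano_base_def pascal_base_def)
  show "coded fano_base"
    unfolding coded_def by (rule conjI[OF fin(1) bexI]) (rule fano, rule mem(1))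
  show "coded pascal_base"
    unfolding coded_def by (rule conjI[OF fin(2) bexI]) (rule pascal, rule mem(2))
qed

lemma coded_config:
  assumes "C \<in> configs"
  shows "coded C"
  using assms
proof (rule UnE)
  assume "C \<in> fano_configs"
  then obtain \<sigma> where \<sigma>: "C = (`) \<sigma> ` fano_base" "\<sigma> permutes {1..7}"
    unfolding fano_configs_def by (elim CollectE exE conjE)
  show ?thesis
    unfolding \<sigma>(1) by (rule coded_permutes[OF \<sigma>(2) coded_base(1)])
next
  assume "C \<in> pascal_configs"
  then obtain \<sigma> where \<sigma>: "C = (`) \<sigma> ` pascal_base" "\<sigma> permutes {1..7}"
    unfolding pascal_configs_def by (elim CollectE exE conjE)
  show ?thesis
    unfolding \<sigma>(1) by (rule coded_permutes[OF \<sigma>(2) coded_base(2)])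
qed

lemma finite_Rep_param: "finite (Rep_goepel_param v)"
proof -
  have "Rep_goepel_param v \<subseteq> {1..7}"
    using Rep_goepel_param[of v] by simp
  then show ?thesis
    by (rule finite_subset) simp
qed

definition codes :: "nat list \<Rightarrow> goepel_config \<Rightarrow> bool" where
  "codes L \<Lambda> \<longleftrightarrow> L \<in> set config_codes \<and> set L = set_encode ` Rep_goepel_config \<Lambda>"

lemma obtain_code:
  obtains L where "codes L \<Lambda>"
proof -
  obtain L where "L \<in> set config_codes" "set L = set_encode ` Rep_goepel_config \<Lambda>"
    using coded_config[OF Rep_goepel_config[of \<Lambda>]] unfolding coded_def by (elim conjE bexE)
  then show thesis
    by (intro that[of L]) (simp only: codes_def simp_thms)
qed

lemma obtain_coded:
  assumes "L \<in> set config_codes"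
  obtains \<Lambda> where "codes L \<Lambda>"
proof -
  obtain C where C: "C \<in> configs" "set L = set_encode ` C"
    using config_code_is_config[OF assms] by (elim bexE)
  have "codes L (Abs_goepel_config C)"
    unfolding codes_def Abs_goepel_config_inverse[OF C(1)] by (rule conjI[OF assms C(2)])
  then show thesis
    by (rule that)
qed

lemma in_config_code_iff:
  assumes "codes L \<Lambda>"
  shows "in_config v \<Lambda> \<longleftrightarrow> set_encode (Rep_goepel_param v) \<in> set L"
proof -
  have fin: "Rep_goepel_config \<Lambda> \<subseteq> Collect finite" "Rep_goepel_param v \<in> Collect finite"
    using coded_config[OF Rep_goepel_config[of \<Lambda>]] finite_Rep_param[of v] by (auto simp: coded_def)
  have "set_encode (Rep_goepel_param v) \<in> set_encode ` Rep_goepel_config \<Lambda> \<longleftrightarrow>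
      Rep_goepel_param v \<in> Rep_goepel_config \<Lambda>"
    by (rule inj_on_image_mem_iff[OF inj_on_set_encode fin(2,1)])
  then show ?thesis
    using assms by (simp only: codes_def in_config_def)
qed

lemma card_goepel_config: "CARD(goepel_config) = 135"
proof -
  have "CARD(goepel_config) = card configs"
    by (rule type_definition.card[OF type_definition_goepel_config])
  also have "\<dots> = card ((`) set_encode ` configs)"
  proof (rule card_image[symmetric], rule inj_onI)
    fix C D assume CD: "C \<in> configs" "D \<in> configs" "set_encode ` C = set_encode ` D"
    have "C \<subseteq> Collect finite" "D \<subseteq> Collect finite"
      using coded_config[OF CD(1)] coded_config[OF CD(2)] by (auto simp: coded_def)
    then show "C = D"
      using CD(3) inj_on_image_eq_iff[OF inj_on_set_encode] by simp
  qed
  also have "(`) set_encode ` configs = set ` set config_codes"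
  proof
    show "(`) set_encode ` configs \<subseteq> set ` set config_codes"
    proof
      fix X assume "X \<in> (`) set_encode ` configs"
      then obtain C where C: "C \<in> configs" "X = set_encode ` C"
        by (elim imageE)
      obtain L where "L \<in> set config_codes" "set L = set_encode ` C"
        using coded_config[OF C(1)] unfolding coded_def by (elim conjE bexE)
      then show "X \<in> set ` set config_codes"
        using C(2) by (simp add: rev_image_eqI)
    qed
    show "set ` set config_codes \<subseteq> (`) set_encode ` configs"
    proof
      fix X assume "X \<in> set ` set config_codes"
      then obtain L where L: "L \<in> set config_codes" "X = set L"
        by (elim imageE)
      obtain C where "C \<in> configs" "X = set_encode ` C"
        using config_code_is_config[OF L(1)] unfolding L(2) by (elim bexE)
      then show "X \<in> (`) set_encode ` configs"
        by (simp only: image_eqI)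
    qed
  qed
  also have "card (set ` set config_codes) = card (set config_codes)"
  proof (rule card_image, rule inj_onI)
    fix L M assume "L \<in> set config_codes" "M \<in> set config_codes" "set L = set M"
    then show "L = M"
      using config_codes_wellformed[of L] config_codes_wellformed[of M]
      by (intro sorted_distinct_set_unique) simp_all
  qed
  also have "\<dots> = 135"
    by (simp add: distinct_card[OF distinct_config_codes] length_config_codes)
  finally show ?thesis .
qed

lemma card_config: "card {v. in_config v \<Lambda>} = 7"
proof -
  obtain L where L: "codes L \<Lambda>"
    by (rule obtain_code)
  let ?e = "\<lambda>v. set_encode (Rep_goepel_param v)"
  have "inj ?e"
    by (rule injI) (simp add: set_encode_eq finite_Rep_param Rep_goepel_param_inject)
  then have "card {v. in_config v \<Lambda>} = card (?e ` {v. in_config v \<Lambda>})"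
    by (simp add: card_image inj_on_subset)
  also have "?e ` {v. in_config v \<Lambda>} = set_encode ` (Rep_goepel_param ` {v. in_config v \<Lambda>})"
    by (simp add: image_image)
  also have "Rep_goepel_param ` {v. in_config v \<Lambda>} = Rep_goepel_config \<Lambda>"
    using config_subset_params[of \<Lambda>] by (auto simp: in_config_def)
  also have "set_encode ` Rep_goepel_config \<Lambda> = set L"
    using L by (simp add: codes_def)
  also have "card (set L) = 7"
    using config_codes_wellformed[of L] distinct_card[of L] L by (simp only: codes_def simp_thms)
  finally show ?thesis .
qed

section \<open>The triples determine a configuration\<close>

text \<open>A relation between the membership of \<open>S\<close>, which has one or two elements, and of the triples in a configuration.
  Let \<open>N\<close> be the number of triples \<open>T\<close> in the configuration, and \<open>p\<close> the number of those that contain \<open>S\<close> or,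
  if \<open>S\<close> is a pair, are disjoint from it. If the triples are regarded as splittings of
  \<open>{1..8}\<close> into two quadruples and a point \<open>i\<close> as the pair of \<open>i\<close> and 8, then \<open>p\<close> counts the splittings
  that do not separate the pair. In a Fano configuration \<open>N = 7\<close> and \<open>p = 3\<close>. In a Pascal configuration
  \<open>N = 3\<close>, and \<open>p\<close> is 3 if \<open>S\<close> belongs to it and 1 otherwise. In all cases
  \<open>4 * of_bool (S \<in> C) + N - 2 * p = 1\<close>.\<close>

definition triple_relation :: "nat set \<Rightarrow> nat set \<Rightarrow> int" where
  "triple_relation S T = 4 * of_bool (T \<subseteq> S \<and> S \<subseteq> T) +
    of_bool (card T = 3) * (1 - 2 * of_bool (S \<subseteq> T \<or> card S = 2 \<and> S \<inter> T = {}))"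

lemma sum_fano_base: "(\<Sum>T\<in>fano_base. f T) = f {1,2,4} + (f {2,3,5} + (f {3,4,6} +
    (f {4,5,7} + (f {1,5,6} + (f {2,6,7} + f {1,3,7})))))"
  for f :: "nat set \<Rightarrow> int"
  unfolding fano_base_def by (simp add: set_eq_subset)

lemma sum_pascal_base: "(\<Sum>T\<in>pascal_base. f T) = f {1,2} + (f {3,4} + (f {5,6} +
    (f {7} + (f {1,2,7} + (f {3,4,7} + f {5,6,7})))))"
  for f :: "nat set \<Rightarrow> int"
  unfolding pascal_base_def by (simp add: set_eq_subset)

text \<open>The indicator of the splitting given by the triple \<open>abc\<close> separating the pair \<open>ij\<close>, where \<open>i = j\<close> stands for
  the pair of \<open>i\<close> and 8; the point 8 is on the side of the triple.\<close>

definition triple_separates :: "nat \<Rightarrow> nat \<Rightarrow> nat \<Rightarrow> nat \<Rightarrow> nat \<Rightarrow> int" where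
  "triple_separates i j a b c = (if i = j then of_bool (i \<noteq> a \<and> i \<noteq> b \<and> i \<noteq> c) else
     of_bool ((i = a \<or> i = b \<or> i = c) \<noteq> (j = a \<or> j = b \<or> j = c)))"

definition same_pair :: "nat \<Rightarrow> nat \<Rightarrow> nat \<Rightarrow> nat \<Rightarrow> int" where
  "same_pair i j a b = of_bool (i = a \<and> j = b \<or> i = b \<and> j = a)"

lemma triple_relation_triple:
  assumes "distinct [a, b, c]"
  shows "triple_relation {i, j} {a, b, c} = 2 * triple_separates i j a b c - 1"
proof -
  define Y where "Y \<longleftrightarrow> (if i = j then i \<noteq> a \<and> i \<noteq> b \<and> i \<noteq> c
    else (i = a \<or> i = b \<or> i = c) \<noteq> (j = a \<or> j = b \<or> j = c))"
  have "\<not> {a, b, c} \<subseteq> {i, j}"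
    using assms by auto
  moreover have "card {a, b, c} = 3"
    using assms by simp
  moreover have "{i, j} \<subseteq> {a, b, c} \<or> card {i, j} = 2 \<and> {i, j} \<inter> {a, b, c} = {} \<longleftrightarrow> \<not> Y"
    by (cases "i = j") (auto simp: Y_def)
  ultimately have "triple_relation {i, j} {a, b, c} = 1 - 2 * of_bool (\<not> Y)"
    by (simp only: triple_relation_def simp_thms of_bool_eq mult_zero_right add_0_left mult_1_left)
  also have "\<dots> = 2 * of_bool Y - 1"
    by (cases Y) simp_all
  also have "of_bool Y = triple_separates i j a b c"
    by (cases "i = j") (simp_all add: Y_def triple_separates_def)
  finally show ?thesis .
qed

lemma triple_relation_pair: "triple_relation {i, j} {a, b} = 4 * same_pair i j a b"
proof -
  have "card {a, b} \<noteq> 3"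
    by (simp add: card_insert_if)
  moreover have "{a, b} \<subseteq> {i, j} \<and> {i, j} \<subseteq> {a, b} \<longleftrightarrow> i = a \<and> j = b \<or> i = b \<and> j = a"
    by auto
  ultimately show ?thesis
    by (simp only: triple_relation_def same_pair_def of_bool_eq mult_zero_left add_0_right)
qed

lemma triple_relation_single: "triple_relation {i, j} {a} = 4 * same_pair i j a a"
  using triple_relation_pair[of i j a a] by (simp only: insert_absorb2)

text \<open>The relation for \<open>S = {i, j}\<close> in the two base configurations, written out; \<open>i = j\<close> covers the
  single points.\<close>

definition base_relation :: "nat \<Rightarrow> nat \<Rightarrow> bool" where
  "base_relation i j \<longleftrightarrow>
    triple_separates i j 1 2 4 + (triple_separates i j 2 3 5 + (triple_separates i j 3 4 6 + (triple_separates i j 4 5 7 + (triple_separates i j 1 5 6 + (triple_separates i j 2 6 7 + (triple_separates i j 1 3 7)))))) = 4 \<and>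
    triple_separates i j 1 2 7 + (triple_separates i j 3 4 7 + triple_separates i j 5 6 7) +
      (2 * same_pair i j 1 2 + (2 * same_pair i j 3 4 +
        (2 * same_pair i j 5 6 + 2 * same_pair i j 7 7))) = 2"

lemma base_relation_all:
  "list_all (\<lambda>i. list_all (base_relation i) [1, 2, 3, 4, 5, 6, 7]) [1, 2, 3, 4, 5, 6, 7]"
  unfolding list.pred_inject
  by (simp add: base_relation_def triple_separates_def same_pair_def)

lemma base_relation_sum:
  assumes "base_relation i j"
  shows "(\<Sum>T\<in>fano_base. triple_relation {i, j} T) = 1" "(\<Sum>T\<in>pascal_base. triple_relation {i, j} T) = 1"
proof -
  have triples: "triple_relation {i, j} {1, 2, 4} = 2 * triple_separates i j 1 2 4 - 1"
    "triple_relation {i, j} {2, 3, 5} = 2 * triple_separates i j 2 3 5 - 1"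
    "triple_relation {i, j} {3, 4, 6} = 2 * triple_separates i j 3 4 6 - 1"
    "triple_relation {i, j} {4, 5, 7} = 2 * triple_separates i j 4 5 7 - 1"
    "triple_relation {i, j} {1, 5, 6} = 2 * triple_separates i j 1 5 6 - 1"
    "triple_relation {i, j} {2, 6, 7} = 2 * triple_separates i j 2 6 7 - 1"
    "triple_relation {i, j} {1, 3, 7} = 2 * triple_separates i j 1 3 7 - 1"
    "triple_relation {i, j} {1, 2, 7} = 2 * triple_separates i j 1 2 7 - 1"
    "triple_relation {i, j} {3, 4, 7} = 2 * triple_separates i j 3 4 7 - 1"
    "triple_relation {i, j} {5, 6, 7} = 2 * triple_separates i j 5 6 7 - 1"
    by (rule triple_relation_triple, simp)+
  show "(\<Sum>T\<in>fano_base. triple_relation {i, j} T) = 1"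
    using conjunct1[OF assms[unfolded base_relation_def]] unfolding sum_fano_base triples by linarith
  show "(\<Sum>T\<in>pascal_base. triple_relation {i, j} T) = 1"
    using conjunct2[OF assms[unfolded base_relation_def]]
    unfolding sum_pascal_base triples triple_relation_pair triple_relation_single
    by presburger
qed

lemma sum_triple_relation_base:
  assumes "S \<subseteq> {1..7}" "card S = 1 \<or> card S = 2" "B = fano_base \<or> B = pascal_base"
  shows "(\<Sum>T\<in>B. triple_relation S T) = 1"
proof -
  obtain i j where S: "S = {i, j}"
  proof -
    from assms(2) show thesis
    proof
      assume "card S = 1"
      then obtain i where "S = {i}"
        by (rule card_1_singletonE)
      then have "S = {i, i}"
        by simp
      then show thesis
        by (rule that)
    next
      assume "card S = 2"
      then obtain i j where "S = {i, j}"
        by (auto simp: card_2_iff)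
      then show thesis
        by (rule that)
    qed
  qed
  have "set [1, 2, 3, 4, 5, 6, 7] = {1..7 :: nat}"
    by auto
  then have i: "i \<in> set [1, 2, 3, 4, 5, 6, 7]" and j: "j \<in> set [1, 2, 3, 4, 5, 6, 7]"
    using assms(1) S by simp_all
  have "base_relation i j"
    by (rule bspec[OF bspec[OF base_relation_all[unfolded list_all_iff] i] j])
  then show ?thesis
    using assms(3) base_relation_sum unfolding S by auto
qed

lemma triple_relation_image:
  assumes "inj \<sigma>"
  shows "triple_relation (\<sigma> ` S) (\<sigma> ` T) = triple_relation S T"
  using assms
  by (simp add: triple_relation_def inj_image_subset_iff card_image inj_on_subset flip: image_Int)

text \<open>The relation is invariant under relabelling, so it suffices to know it for the base configurations.\<close>

lemma sum_triple_relation: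
  assumes "C \<in> configs" "S \<subseteq> {1..7}" "card S = 1 \<or> card S = 2"
  shows "(\<Sum>T\<in>C. triple_relation S T) = 1"
proof -
  obtain \<sigma> B where \<sigma>: "\<sigma> permutes {1..7}" and B: "B = fano_base \<or> B = pascal_base"
    and C: "C = (`) \<sigma> ` B"
    using assms(1) unfolding fano_configs_def pascal_configs_def by auto
  have inj: "inj \<sigma>"
    by (rule permutes_inj[OF \<sigma>])
  define R where "R = inv \<sigma> ` S"
  have S: "S = \<sigma> ` R"
    by (simp add: R_def image_image permutes_inverses[OF \<sigma>])
  have "R \<subseteq> inv \<sigma> ` {1..7}"
    unfolding R_def by (rule image_mono[OF assms(2)])
  then have R7: "R \<subseteq> {1..7}"
    by (simp only: permutes_image[OF permutes_inv[OF \<sigma>]])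
  have card: "card R = card S"
    unfolding S by (rule card_image[symmetric, OF inj_on_subset[OF inj subset_UNIV]])
  have "(\<Sum>T\<in>C. triple_relation S T) = (\<Sum>T\<in>B. triple_relation (\<sigma> ` R) (\<sigma> ` T))"
    unfolding C S by (rule sum.reindex_cong[where l = "(`) \<sigma>"])
      (auto intro: inj_on_subset[OF inj_image_eq_iff[OF inj, THEN iffD1, THEN injI]])
  also have "\<dots> = (\<Sum>T\<in>B. triple_relation R T)"
    by (simp only: triple_relation_image[OF inj])
  also have "\<dots> = 1"
    using assms(3) by (intro sum_triple_relation_base R7 B) (simp only: card)
  finally show ?thesis .
qed

lemma Rep_param_subset: "Rep_goepel_param v \<subseteq> {1..7}"
  and Rep_param_card: "card (Rep_goepel_param v) = 1 \<or> card (Rep_goepel_param v) = 2 \<or> card (Rep_goepel_param v) = 3"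
  using Rep_goepel_param[of v] by auto

lemma Rep_image_config: "Rep_goepel_param ` {v. in_config v \<Lambda>} = Rep_goepel_config \<Lambda>"
  using config_subset_params[of \<Lambda>] by (auto simp: in_config_def)

definition triples :: "goepel_param set" where
  "triples = {v. card (Rep_goepel_param v) = 3}"

text \<open>For a triple there is nothing to show, and for the other parameters the relation above is solved
  for the membership of \<open>v\<close>.\<close>

lemma triples_determine_config: "affinely_determined_by in_config triples"
  unfolding affinely_determined_by_def
proof
  fix v
  show "\<exists>(r0 :: real) r. \<forall>\<Lambda>. of_bool (in_config v \<Lambda>) = r0 + (\<Sum>b\<in>triples. r b * of_bool (in_config b \<Lambda>))"
  proof (cases "v \<in> triples")
    case True
    have "of_bool (in_config v \<Lambda>) = (0 :: real) + (\<Sum>b\<in>triples. of_bool (b = v) * of_bool (in_config b \<Lambda>))" for \<Lambda>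
    proof -
      have "(\<Sum>b\<in>triples. of_bool (b = v) * of_bool (in_config b \<Lambda>)) =
          (\<Sum>b\<in>triples. if b = v then of_bool (in_config v \<Lambda>) else (0 :: real))"
        by (rule sum.cong) auto
      then show ?thesis
        using True by (simp add: sum.delta)
    qed
    then show ?thesis
      by (intro exI allI)
  next
    case False
    then have card: "card (Rep_goepel_param v) = 1 \<or> card (Rep_goepel_param v) = 2"
      using Rep_param_card[of v] by (simp add: triples_def)
    define q :: "goepel_param \<Rightarrow> int" where "q b = 1 - 2 * of_bool (Rep_goepel_param v \<subseteq> Rep_goepel_param b \<or>
      card (Rep_goepel_param v) = 2 \<and> Rep_goepel_param v \<inter> Rep_goepel_param b = {})" for b
    have rel: "triple_relation (Rep_goepel_param v) (Rep_goepel_param b) =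
        4 * of_bool (b = v) + of_bool (b \<in> triples) * q b" for b
    proof -
      have "Rep_goepel_param b \<subseteq> Rep_goepel_param v \<and> Rep_goepel_param v \<subseteq> Rep_goepel_param b \<longleftrightarrow> b = v"
        unfolding set_eq_subset[symmetric] by (rule Rep_goepel_param_inject)
      then show ?thesis
        by (simp only: triple_relation_def q_def triples_def mem_Collect_eq)
    qed
    have "of_bool (in_config v \<Lambda>) = (1 / 4 :: real) + (\<Sum>b\<in>triples. - of_int (q b) / 4 * of_bool (in_config b \<Lambda>))" for \<Lambda>
    proof -
      have "1 = (\<Sum>T\<in>Rep_goepel_config \<Lambda>. triple_relation (Rep_goepel_param v) T)"
        by (rule sum_triple_relation[OF Rep_goepel_config Rep_param_subset card, symmetric])
      also have "\<dots> = (\<Sum>b | in_config b \<Lambda>. triple_relation (Rep_goepel_param v) (Rep_goepel_param b))"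
        unfolding Rep_image_config[symmetric]
        by (subst sum.reindex) (simp_all add: inj_on_def Rep_goepel_param_inject)
      also have "\<dots> = (\<Sum>b\<in>UNIV. of_bool (in_config b \<Lambda>) * (4 * of_bool (b = v) + of_bool (b \<in> triples) * q b))"
        by (rule sum.mono_neutral_cong_left) (simp_all add: rel)
      also have "\<dots> = (\<Sum>b\<in>UNIV. if b = v then 4 * of_bool (in_config v \<Lambda>) else 0) +
          (\<Sum>b\<in>UNIV. of_bool (b \<in> triples) * (q b * of_bool (in_config b \<Lambda>)))"
        unfolding sum.distrib[symmetric] by (rule sum.cong) (auto simp: distrib_left)
      also have "(\<Sum>b\<in>UNIV. of_bool (b \<in> triples) * (q b * of_bool (in_config b \<Lambda>))) =
          (\<Sum>b\<in>triples. q b * of_bool (in_config b \<Lambda>))"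
        by (rule sum.mono_neutral_cong_right) simp_all
      finally have "(1 :: int) = 4 * of_bool (in_config v \<Lambda>) + (\<Sum>b\<in>triples. q b * of_bool (in_config b \<Lambda>))"
        by simp
      then have "real_of_int 1 = of_int (4 * of_bool (in_config v \<Lambda>) + (\<Sum>b\<in>triples. q b * of_bool (in_config b \<Lambda>)))"
        by (simp only:)
      then have "(1 :: real) = 4 * of_bool (in_config v \<Lambda>) + (\<Sum>b\<in>triples. of_int (q b) * of_bool (in_config b \<Lambda>))"
        by (simp only: of_int_add of_int_mult of_int_sum of_int_of_bool of_int_1 of_int_numeral)
      moreover have "(\<Sum>b\<in>triples. - of_int (q b) / 4 * of_bool (in_config b \<Lambda>)) =
          - (\<Sum>b\<in>triples. of_int (q b) * of_bool (in_config b \<Lambda>)) / (4 :: real)"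
        unfolding sum_negf[symmetric] sum_divide_distrib by (rule sum.cong) simp_all
      ultimately show ?thesis
        by argo
    qed
    then show ?thesis
      by (intro exI allI)
  qed
qed

lemma card_goepel_param: "CARD(goepel_param) = 63" and card_triples: "card triples = 35"
proof -
  define sub :: "nat \<Rightarrow> nat set set" where "sub k = {S. S \<subseteq> {1..7} \<and> card S = k}" for k
  have card: "card (sub k) = 7 choose k" "finite (sub k)" for k
    unfolding sub_def using n_subsets[of "{1..7 :: nat}" k] by simp_all
  have choose: "7 choose 1 = (7::nat)" "7 choose 2 = (21::nat)" "7 choose 3 = (35::nat)"
    by (simp_all add: numeral_eq_Suc)
  have "{S. S \<subseteq> {1..7} \<and> card S \<in> {1, 2, 3}} = sub 1 \<union> (sub 2 \<union> sub 3)"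
    by (auto simp: sub_def)
  moreover have "card (sub 1 \<union> (sub 2 \<union> sub 3)) = 63"
    by (subst card_Un_disjoint; (subst card_Un_disjoint)?) (auto simp: card choose, auto simp: sub_def)
  ultimately show "CARD(goepel_param) = 63"
    using type_definition.card[OF type_definition_goepel_param] by simp
  have "Rep_goepel_param ` triples = sub 3"
  proof
    show "Rep_goepel_param ` triples \<subseteq> sub 3"
      using Rep_param_subset by (auto simp: triples_def sub_def)
    show "sub 3 \<subseteq> Rep_goepel_param ` triples"
    proof
      fix S assume S: "S \<in> sub 3"
      then have "Rep_goepel_param (Abs_goepel_param S) = S"
        by (intro Abs_goepel_param_inverse) (simp add: sub_def)
      then show "S \<in> Rep_goepel_param ` triples"
        using S by (intro rev_image_eqI[of "Abs_goepel_param S"]) (simp_all add: triples_def sub_def)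
    qed
  qed
  moreover have "card (Rep_goepel_param ` triples) = card triples"
    by (rule card_image) (simp add: inj_on_def Rep_goepel_param_inject)
  ultimately show "card triples = 35"
    by (simp add: card choose)
qed

section \<open>Symmetry under relabelling the seven points\<close>

definition param_act :: "(nat \<Rightarrow> nat) \<Rightarrow> goepel_param \<Rightarrow> goepel_param" where
  "param_act \<sigma> v = Abs_goepel_param (\<sigma> ` Rep_goepel_param v)"

definition config_act :: "(nat \<Rightarrow> nat) \<Rightarrow> goepel_config \<Rightarrow> goepel_config" where
  "config_act \<sigma> \<Lambda> = Abs_goepel_config ((`) \<sigma> ` Rep_goepel_config \<Lambda>)"

lemma Rep_param_act:
  assumes "\<sigma> permutes {1..7}"
  shows "Rep_goepel_param (param_act \<sigma> v) = \<sigma> ` Rep_goepel_param v"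
  unfolding param_act_def
proof (rule Abs_goepel_param_inverse)
  have "\<sigma> ` Rep_goepel_param v \<subseteq> {1..7}"
    using image_mono[OF Rep_param_subset, of \<sigma> v] unfolding permutes_image[OF assms] .
  moreover have "card (\<sigma> ` Rep_goepel_param v) = card (Rep_goepel_param v)"
    by (rule card_image[OF inj_on_subset[OF permutes_inj[OF assms] subset_UNIV]])
  ultimately show "\<sigma> ` Rep_goepel_param v \<in> {S. S \<subseteq> {1..7} \<and> card S \<in> {1, 2, 3}}"
    using Rep_param_card[of v] by simp
qed

lemma configs_image:
  assumes \<sigma>: "\<sigma> permutes {1..7}" and "C \<in> configs"
  shows "(`) \<sigma> ` C \<in> configs"
proof -
  have comp: "(`) \<sigma> ` (`) \<tau> ` B = (`) (\<sigma> \<circ> \<tau>) ` B" for \<tau> :: "nat \<Rightarrow> nat" and B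
    by (simp add: image_image image_comp)
  from \<open>C \<in> configs\<close> show ?thesis
  proof (rule UnE)
    assume "C \<in> fano_configs"
    then obtain \<tau> where \<tau>: "C = (`) \<tau> ` fano_base" "\<tau> permutes {1..7}"
      unfolding fano_configs_def by (elim CollectE exE conjE)
    show ?thesis
      unfolding \<tau>(1) comp fano_configs_def
      by (rule UnI1, rule CollectI, rule exI, rule conjI[OF refl permutes_compose[OF \<tau>(2) \<sigma>]])
  next
    assume "C \<in> pascal_configs"
    then obtain \<tau> where \<tau>: "C = (`) \<tau> ` pascal_base" "\<tau> permutes {1..7}"
      unfolding pascal_configs_def by (elim CollectE exE conjE)
    show ?thesis
      unfolding \<tau>(1) comp pascal_configs_def
      by (rule UnI2, rule CollectI, rule exI, rule conjI[OF refl permutes_compose[OF \<tau>(2) \<sigma>]])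
  qed
qed

lemma in_config_act:
  assumes "\<sigma> permutes {1..7}"
  shows "in_config (param_act \<sigma> v) (config_act \<sigma> \<Lambda>) \<longleftrightarrow> in_config v \<Lambda>"
proof -
  have "Rep_goepel_config (config_act \<sigma> \<Lambda>) = (`) \<sigma> ` Rep_goepel_config \<Lambda>"
    unfolding config_act_def
    by (rule Abs_goepel_config_inverse[OF configs_image[OF assms Rep_goepel_config]])
  then show ?thesis
    by (simp add: in_config_def Rep_param_act[OF assms] image_iff inj_image_eq_iff[OF permutes_inj[OF assms]])
qed

text \<open>What is needed of a parameter: a separating sequence for the configurations avoiding it, for the
  dimension of its divisor, and two configurations that meet only in it, for telling its divisor
  from the others.\<close>

definition certified :: "goepel_param \<Rightarrow> bool" where
  "certified v \<longleftrightarrow> (\<exists>bs. length bs = 34 \<and> separating in_config {v} bs) \<and>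
    (\<exists>\<Lambda> \<Lambda>'. in_config v \<Lambda> \<and> in_config v \<Lambda>' \<and> (\<forall>w. in_config w \<Lambda> \<and> in_config w \<Lambda>' \<longrightarrow> w = v))"

lemma certified_act:
  assumes \<sigma>: "\<sigma> permutes {1..7}" and "certified v"
  shows "certified (param_act \<sigma> v)"
proof -
  note act = in_config_act[OF \<sigma>]
  obtain bs where bs: "length bs = 34" "separating in_config {v} bs"
    using assms(2) unfolding certified_def by (elim conjE exE)
  obtain \<Lambda> \<Lambda>' where meet: "in_config v \<Lambda>" "in_config v \<Lambda>'" "\<forall>w. in_config w \<Lambda> \<and> in_config w \<Lambda>' \<longrightarrow> w = v"
    using assms(2) unfolding certified_def by (elim conjE exE)
  have "separating in_config {param_act \<sigma> v} (map (param_act \<sigma>) bs)"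
    unfolding separating_def
  proof (intro allI impI)
    fix i assume "i < length (map (param_act \<sigma>) bs)"
    then have i: "i < length bs"
      by simp
    obtain c c' where c: "\<forall>u\<in>{v}. \<not> in_config u c \<and> \<not> in_config u c'"
      "\<forall>j<i. in_config (bs ! j) c \<longleftrightarrow> in_config (bs ! j) c'" "in_config (bs ! i) c" "\<not> in_config (bs ! i) c'"
      using bs(2)[unfolded separating_def, rule_format, OF i] by (elim exE conjE)
    show "\<exists>d d'. (\<forall>u\<in>{param_act \<sigma> v}. \<not> in_config u d \<and> \<not> in_config u d') \<and>
        (\<forall>j<i. in_config (map (param_act \<sigma>) bs ! j) d \<longleftrightarrow> in_config (map (param_act \<sigma>) bs ! j) d') \<and>
        in_config (map (param_act \<sigma>) bs ! i) d \<and> \<not> in_config (map (param_act \<sigma>) bs ! i) d'"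
      by (rule exI[of _ "config_act \<sigma> c"], rule exI[of _ "config_act \<sigma> c'"]) (use i c in \<open>simp add: act\<close>)
  qed
  moreover have "w = param_act \<sigma> v"
    if "in_config w (config_act \<sigma> \<Lambda>)" "in_config w (config_act \<sigma> \<Lambda>')" for w
  proof -
    have "Rep_goepel_param (param_act \<sigma> (param_act (inv \<sigma>) w)) = Rep_goepel_param w"
      by (simp only: Rep_param_act[OF \<sigma>] Rep_param_act[OF permutes_inv[OF \<sigma>]] image_image
          permutes_inverses(1)[OF \<sigma>] image_ident)
    then have w: "param_act \<sigma> (param_act (inv \<sigma>) w) = w"
      by (simp only: Rep_goepel_param_inject)
    have "in_config (param_act (inv \<sigma>) w) \<Lambda>" "in_config (param_act (inv \<sigma>) w) \<Lambda>'"
      using that act[of "param_act (inv \<sigma>) w"] by (simp_all only: w)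
    then have "param_act (inv \<sigma>) w = v"
      using meet(3) by simp
    then show ?thesis
      using w by simp
  qed
  ultimately show ?thesis
    unfolding certified_def using meet(1,2) bs(1) act
    by (intro conjI exI[of _ "map (param_act \<sigma>) bs"] exI[of _ "config_act \<sigma> \<Lambda>"] exI[of _ "config_act \<sigma> \<Lambda>'"]) simp_all
qed

lemma ex_permutes_image:
  fixes A B S :: "'a set"
  assumes "finite S" "A \<subseteq> S" "B \<subseteq> S" "card A = card B"
  obtains \<sigma> where "\<sigma> permutes S" "\<sigma> ` A = B"
proof -
  have fin: "finite A" "finite B" "finite (S - A)" "finite (S - B)"
    using assms finite_subset by auto
  obtain f where f: "bij_betw f A B"
    using finite_same_card_bij[OF fin(1,2) assms(4)] by (elim exE)
  have "card (S - A) = card (S - B)"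
    using assms by (simp add: card_Diff_subset fin)
  then obtain g where g: "bij_betw g (S - A) (S - B)"
    using finite_same_card_bij[OF fin(3,4)] by (elim meta_impE exE)
  define \<sigma> where "\<sigma> x = (if x \<in> A then f x else if x \<in> S then g x else x)" for x
  have A: "bij_betw \<sigma> A B"
    using f by (rule bij_betw_cong[THEN iffD1, rotated]) (simp add: \<sigma>_def)
  have "bij_betw \<sigma> (S - A) (S - B)"
    using g by (rule bij_betw_cong[THEN iffD1, rotated]) (simp add: \<sigma>_def)
  then have "bij_betw \<sigma> (A \<union> (S - A)) (B \<union> (S - B))"
    using A by (intro bij_betw_combine) auto
  then have "bij_betw \<sigma> S S"
    using assms(2,3) by (simp add: Un_absorb1)
  then have "\<sigma> permutes S"
    by (rule bij_imp_permutes) (use assms(2) in \<open>auto simp: \<sigma>_def\<close>)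
  then show thesis
    using that A by (simp add: bij_betw_def)
qed

text \<open>Every code in the list that splits a block occurs in a configuration, so it is the code of a
  parameter.\<close>

lemma separating_of_codes:
  assumes v: "set_encode (Rep_goepel_param v) = c" and sep: "separates bs [avoiding c config_codes]"
  shows "separating in_config {v} (map (\<lambda>b. Abs_goepel_param (set_decode b)) bs)"
proof -
  have step: "\<exists>L\<in>set (avoiding c config_codes). \<exists>M\<in>set (avoiding c config_codes).
      (\<forall>j<i. bs ! j \<in> set L \<longleftrightarrow> bs ! j \<in> set M) \<and> bs ! i \<in> set L \<and> bs ! i \<notin> set M" if "i < length bs" for i
    using separatesD[OF sep that] by simp
  have decode: "set_encode (Rep_goepel_param (Abs_goepel_param (set_decode (bs ! i)))) = bs ! i"
    if i: "i < length bs" for i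
  proof -
    obtain L where L: "L \<in> set config_codes" "bs ! i \<in> set L"
      using step[OF i] by (auto simp: set_avoiding)
    obtain \<Lambda> where \<Lambda>: "codes L \<Lambda>"
      using L(1) by (rule obtain_coded)
    have "bs ! i \<in> set_encode ` Rep_goepel_param ` {u. in_config u \<Lambda>}"
      using L(2) \<Lambda> unfolding Rep_image_config by (simp only: codes_def)
    then obtain u where "bs ! i = set_encode (Rep_goepel_param u)"
      by (elim imageE) (simp only:)
    then show ?thesis
      by (simp add: finite_Rep_param Rep_goepel_param_inverse)
  qed
  show ?thesis
    unfolding separating_def
  proof (intro allI impI)
    let ?bs = "map (\<lambda>b. Abs_goepel_param (set_decode b)) bs"
    fix i assume "i < length ?bs"
    then have i: "i < length bs"
      by simp
    obtain L M where LM: "L \<in> set config_codes" "M \<in> set config_codes" "c \<notin> set L" "c \<notin> set M"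
      and agree: "\<forall>j<i. bs ! j \<in> set L \<longleftrightarrow> bs ! j \<in> set M" and differ: "bs ! i \<in> set L" "bs ! i \<notin> set M"
      using step[OF i] unfolding set_avoiding by (elim bexE conjE CollectE)
    obtain \<Lambda> where \<Lambda>: "codes L \<Lambda>"
      using LM(1) by (rule obtain_coded)
    obtain \<Lambda>' where \<Lambda>': "codes M \<Lambda>'"
      using LM(2) by (rule obtain_coded)
    have in_iff: "in_config (?bs ! j) \<Lambda> \<longleftrightarrow> bs ! j \<in> set L" "in_config (?bs ! j) \<Lambda>' \<longleftrightarrow> bs ! j \<in> set M"
      if "j < length bs" for j
      using that by (simp_all add: in_config_code_iff[OF \<Lambda>] in_config_code_iff[OF \<Lambda>'] decode)
    show "\<exists>d d'. (\<forall>u\<in>{v}. \<not> in_config u d \<and> \<not> in_config u d') \<and>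
        (\<forall>j<i. in_config (?bs ! j) d \<longleftrightarrow> in_config (?bs ! j) d') \<and>
        in_config (?bs ! i) d \<and> \<not> in_config (?bs ! i) d'"
    proof (rule exI[of _ \<Lambda>], rule exI[of _ \<Lambda>'], intro conjI)
      show "\<forall>u\<in>{v}. \<not> in_config u \<Lambda> \<and> \<not> in_config u \<Lambda>'"
        using LM(3,4) by (simp add: in_config_code_iff[OF \<Lambda>] in_config_code_iff[OF \<Lambda>'] v)
      show "\<forall>j<i. in_config (?bs ! j) \<Lambda> \<longleftrightarrow> in_config (?bs ! j) \<Lambda>'"
        using agree in_iff i by (auto simp del: nth_map)
      show "in_config (?bs ! i) \<Lambda>" "\<not> in_config (?bs ! i) \<Lambda>'"
        using differ in_iff[OF i] by (simp_all only: simp_thms)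
    qed
  qed
qed

lemma certified_of_codes:
  assumes v: "set_encode (Rep_goepel_param v) = c" and "c \<in> set separating_codes"
    and sep: "separates (remove1 c separating_codes) [avoiding c config_codes]"
    and L: "list_ex ((=) L) config_codes" "c \<in> set L"
    and M: "list_ex ((=) M) config_codes" "c \<in> set M"
    and meet: "set L \<inter> set M \<subseteq> {c}"
  shows "certified v"
proof -
  have "length separating_codes = 35"
    by (simp add: separating_codes_def)
  then have "length (remove1 c separating_codes) = 34"
    by (simp add: length_remove1 assms(2))
  then have len: "length (map (\<lambda>b. Abs_goepel_param (set_decode b)) (remove1 c separating_codes)) = 34"
    by (simp only: length_map)
  have "L \<in> set config_codes"
    using L(1) by (simp only: list_ex_iff) (elim bexE, simp only:)
  then obtain \<Lambda> where \<Lambda>: "codes L \<Lambda>"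
    by (rule obtain_coded)
  have "M \<in> set config_codes"
    using M(1) by (simp only: list_ex_iff) (elim bexE, simp only:)
  then obtain \<Lambda>' where \<Lambda>': "codes M \<Lambda>'"
    by (rule obtain_coded)
  have unique: "\<forall>w. in_config w \<Lambda> \<and> in_config w \<Lambda>' \<longrightarrow> w = v"
  proof (intro allI impI)
    fix w assume "in_config w \<Lambda> \<and> in_config w \<Lambda>'"
    then have "set_encode (Rep_goepel_param w) \<in> set L \<inter> set M"
      by (simp add: in_config_code_iff[OF \<Lambda>] in_config_code_iff[OF \<Lambda>'])
    then have "set_encode (Rep_goepel_param w) = set_encode (Rep_goepel_param v)"
      using subsetD[OF meet] by (simp only: v singleton_iff)
    then show "w = v"
      by (simp add: set_encode_eq finite_Rep_param Rep_goepel_param_inject)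
  qed
  have mem: "in_config v \<Lambda>" "in_config v \<Lambda>'"
    by (simp_all only: in_config_code_iff[OF \<Lambda>] in_config_code_iff[OF \<Lambda>'] v L(2) M(2))
  show ?thesis
    unfolding certified_def
  proof
    show "\<exists>bs. length bs = 34 \<and> separating in_config {v} bs"
      by (rule exI, rule conjI[OF len separating_of_codes[OF v sep]])
    show "\<exists>\<Lambda> \<Lambda>'. in_config v \<Lambda> \<and> in_config v \<Lambda>' \<and> (\<forall>w. in_config w \<Lambda> \<and> in_config w \<Lambda>' \<longrightarrow> w = v)"
      by (rule exI, rule exI, rule conjI[OF mem(1) conjI[OF mem(2) unique]])
  qed
qed

text \<open>Parameters of the same size are related by a permutation of the points, so one of each size is enough.\<close>

lemma certified: "certified v"
proof -
  have base: "certified (Abs_goepel_param S)" if "S = {1} \<or> S = {1, 2} \<or> S = {1, 2, 4}" for S :: "nat set"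
  proof -
    have Rep: "Rep_goepel_param (Abs_goepel_param S) = S"
      by (rule Abs_goepel_param_inverse) (use that in auto)
    from that show ?thesis
    proof (elim disjE)
      assume S: "S = {1}"
      show ?thesis
        by (rule certified_of_codes[OF _ _ separates_config_codes_2
              config_codes_meeting_once(1) _ config_codes_meeting_once(2)])
          (unfold Rep, simp_all add: S separating_codes_def)
    next
      assume S: "S = {1, 2}"
      show ?thesis
        by (rule certified_of_codes[OF _ _ separates_config_codes_6
              config_codes_meeting_once(3) _ config_codes_meeting_once(4)])
          (unfold Rep, simp_all add: S separating_codes_def)
    next
      assume S: "S = {1, 2, 4}"
      show ?thesis
        by (rule certified_of_codes[OF _ _ separates_config_codes_22
              config_codes_meeting_once(5) _ config_codes_meeting_once(4)])
          (unfold Rep, simp_all add: S separating_codes_def)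
    qed
  qed
  have move: "certified v" if S: "S = {1} \<or> S = {1, 2} \<or> S = {1, 2, 4}" "card S = card (Rep_goepel_param v)" for S :: "nat set"
  proof -
    have S7: "S \<subseteq> {1..7}" and valid: "S \<in> {S. S \<subseteq> {1..7} \<and> card S \<in> {1, 2, 3}}"
      using S(1) by auto
    obtain \<sigma> where \<sigma>: "\<sigma> permutes {1..7}" "\<sigma> ` S = Rep_goepel_param v"
      using ex_permutes_image[OF finite_atLeastAtMost S7 Rep_param_subset S(2)] .
    have "param_act \<sigma> (Abs_goepel_param S) = v"
      by (simp only: param_act_def Abs_goepel_param_inverse[OF valid] \<sigma>(2) Rep_goepel_param_inverse)
    then show ?thesis
      using certified_act[OF \<sigma>(1) base[OF S(1)]] by (simp only:)
  qed
  show ?thesis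
    using Rep_param_card[of v] move[of "{1}"] move[of "{1, 2}"] move[of "{1, 2, 4}"] by auto
qed

section \<open>The Goepel variety and its boundary\<close>

lemma obtain_separating:
  obtains bs where "length bs = 34" "separating in_config {v} bs"
  using certified[of v] unfolding certified_def by (elim conjE exE)

lemma avoidable_param: "avoidable in_config {v}"
proof -
  obtain bs where bs: "length bs = 34" "separating in_config {v} bs"
    by (rule obtain_separating)
  have "\<exists>c c'. (\<forall>u\<in>{v}. \<not> in_config u c \<and> \<not> in_config u c') \<and>
      (\<forall>j<0. in_config (bs ! j) c \<longleftrightarrow> in_config (bs ! j) c') \<and> in_config (bs ! 0) c \<and> \<not> in_config (bs ! 0) c'"
    by (rule bs(2)[unfolded separating_def, rule_format]) (simp add: bs(1))
  then show ?thesis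
    by (auto simp: avoidable_def)
qed

lemma obtain_config_distinguishing:
  assumes "v \<noteq> w"
  obtains \<Lambda> where "in_config v \<Lambda>" "\<not> in_config w \<Lambda>"
proof -
  obtain \<Lambda> \<Lambda>' where *: "in_config v \<Lambda>" "in_config v \<Lambda>'" "\<forall>w. in_config w \<Lambda> \<and> in_config w \<Lambda>' \<longrightarrow> w = v"
    using certified[of v] unfolding certified_def by (elim conjE exE)
  have "\<not> in_config w \<Lambda> \<or> \<not> in_config w \<Lambda>'"
    using *(3) assms by auto
  then show thesis
  proof
    assume "\<not> in_config w \<Lambda>"
    with *(1) show thesis
      by (rule that)
  next
    assume "\<not> in_config w \<Lambda>'"
    with *(2) show thesis
      by (rule that)
  qed
qed

lemma goepel_variety_eq: "goepel_variety = toric in_config {} {}"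
proof -
  have "goepel_variety = zariski closure_of ((\<lambda>P. abs_proj (monomial_map in_config (rep_proj P))) `
      {P. monomial_map in_config (rep_proj P) \<noteq> 0 \<and> (\<forall>v\<in>{}. rep_proj P $ v = 0)})"
    unfolding goepel_variety_def goepel_map_def goepel_dom_def goepel_monomials_eq by simp
  also have "\<dots> = toric in_config {} {}"
    by (rule toric_eq_closure_slice[OF card_config]) (simp_all add: avoidable_def)
  finally show ?thesis .
qed

lemma boundary_divisor_eq_closure:
  "boundary_divisor v = zariski closure_of (goepel_map ` {P \<in> goepel_dom. rep_proj P $ v = 0})"
proof -
  have "boundary_divisor v = toric in_config {v} {}"
    by (rule boundary_divisor_eq[OF avoidable_param])
  also have "\<dots> = zariski closure_of ((\<lambda>P. abs_proj (monomial_map in_config (rep_proj P))) `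
      {P. monomial_map in_config (rep_proj P) \<noteq> 0 \<and> (\<forall>u\<in>{v}. rep_proj P $ u = 0)})"
    by (rule toric_eq_closure_slice[OF card_config _ avoidable_param, symmetric]) simp
  also have "\<dots> = zariski closure_of (goepel_map ` {P \<in> goepel_dom. rep_proj P $ v = 0})"
    unfolding goepel_map_def goepel_dom_def goepel_monomials_eq by simp
  finally show ?thesis .
qed

lemma boundary_divisor_psubset: "boundary_divisor v \<subset> goepel_variety"
proof -
  obtain \<Lambda> where "in_config v \<Lambda>"
    using certified[of v] unfolding certified_def by (elim conjE exE)
  moreover have "boundary_divisor v \<subseteq> goepel_variety"
    unfolding boundary_divisor_eq_closure goepel_variety_def by (intro closure_of_mono image_mono) auto
  ultimately show ?thesis
    using toric_singleton_psubset[OF _ avoidable_param]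
    unfolding boundary_divisor_eq[OF avoidable_param] goepel_variety_eq by simp
qed

lemma irreducible_boundary_divisor: "irreducible_closedin zariski (boundary_divisor v)"
  unfolding boundary_divisor_eq[OF avoidable_param] by (rule irreducible_toric[OF _ avoidable_param]) simp

lemma irreducible_goepel_variety: "irreducible_closedin zariski goepel_variety"
  unfolding goepel_variety_eq by (rule irreducible_toric) (simp_all add: avoidable_def)

text \<open>The strict inclusion of the divisor into the variety closes the gap between the two bounds.\<close>

lemma zariski_dims: "zariski_dim goepel_variety = 35" "zariski_dim (boundary_divisor v) = 34"
proof -
  have le: "zariski_dim goepel_variety \<le> enat 35"
    using zariski_dim_toric_le[OF triples_determine_config] by (simp only: goepel_variety_eq card_triples)
  have ge: "enat 34 \<le> zariski_dim (boundary_divisor v)" for v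
  proof -
    obtain bs where bs: "length bs = 34" "separating in_config {v} bs"
      by (rule obtain_separating)
    show ?thesis
      using zariski_dim_toric_ge[OF bs(2) avoidable_param]
      by (simp only: boundary_divisor_eq[OF avoidable_param] bs(1))
  qed
  have step: "zariski_dim (boundary_divisor v) + 1 \<le> zariski_dim goepel_variety" for v
    by (rule zariski_dim_proper_subset[OF irreducible_boundary_divisor irreducible_goepel_variety
          boundary_divisor_psubset])
  obtain d e where d: "zariski_dim goepel_variety = enat d" and e: "zariski_dim (boundary_divisor v) = enat e"
    using le step[of v] by (cases "zariski_dim goepel_variety"; cases "zariski_dim (boundary_divisor v)") auto
  have "d = 35 \<and> e = 34"
    using le ge[of v] step[of v] by (simp add: d e one_enat_def)
  then show "zariski_dim goepel_variety = 35" "zariski_dim (boundary_divisor v) = 34"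
    by (simp_all add: d e numeral_eq_enat)
qed

lemma prime_divisor_boundary: "prime_divisor goepel_variety (boundary_divisor v)"
  unfolding prime_divisor_def
proof
  have "closedin zariski goepel_variety"
    using irreducible_goepel_variety by (simp add: irreducible_closedin_def)
  then show "irreducible_closedin (subtopology zariski goepel_variety) (boundary_divisor v)"
    using irreducible_boundary_divisor[of v] boundary_divisor_psubset[of v]
    by (simp add: irreducible_closedin_subtopology_iff psubset_eq)
  have "(34 :: enat) + 1 = 35"
    by (simp add: one_enat_def numeral_eq_enat)
  then show "zariski_dim (boundary_divisor v) + 1 = zariski_dim goepel_variety"
    by (simp only: zariski_dims)
qed

lemma inj_boundary_divisor: "inj boundary_divisor"
proof (rule injI, rule ccontr)
  fix v w assume eq: "boundary_divisor v = boundary_divisor w" and "v \<noteq> w"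
  obtain \<Lambda> where "in_config v \<Lambda>" "\<not> in_config w \<Lambda>"
    using obtain_config_distinguishing[OF \<open>v \<noteq> w\<close>] .
  then have "toric in_config {v} {} \<noteq> toric in_config {w} {}"
    by (rule toric_singleton_neq[OF _ _ avoidable_param])
  then show False
    using eq by (simp add: boundary_divisor_eq[OF avoidable_param])
qed

lemma coordinate_face_facet: "coordinate_face v facet_of goepel_polytope"
proof -
  have vec: "exponent_vec = incidence_vector in_config"
    by (simp add: fun_eq_iff exponent_vec_def incidence_vector_def of_bool_def)
  obtain bs where bs: "length bs = 34" "separating in_config {v} bs"
    by (rule obtain_separating)
  obtain \<Lambda> where \<Lambda>: "in_config v \<Lambda>"
    using certified[of v] unfolding certified_def by (elim conjE exE)
  show ?thesis
    unfolding coordinate_face_def goepel_polytope_def vec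
    by (rule facet_of_coordinate_hyperplane[OF triples_determine_config bs(2) _ avoidable_param \<Lambda>])
      (simp add: bs(1) card_triples)
qed

theorem theorem6p1:
  shows "CARD(goepel_config) = 135 \<and> zariski_dim goepel_variety = 35 \<and>
    inj boundary_divisor \<and> card (range boundary_divisor) = 63 \<and>
    (\<forall>v. coordinate_face v facet_of goepel_polytope \<and>
         prime_divisor goepel_variety (boundary_divisor v) \<and>
         (\<forall>t\<in>torus. torus_act t ` boundary_divisor v = boundary_divisor v) \<and>
         boundary_divisor v =
           zariski closure_of (goepel_map ` {P \<in> goepel_dom. rep_proj P $ v = 0}))"
proof (intro conjI allI ballI)
  show "card (range boundary_divisor) = 63"
    by (simp only: card_image[OF inj_boundary_divisor] card_goepel_param)
  show "torus_act t ` boundary_divisor v = boundary_divisor v" if "t \<in> torus" for t v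
    unfolding boundary_divisor_eq[OF avoidable_param] by (rule torus_act_image_toric[OF that avoidable_param])
qed (rule card_goepel_config zariski_dims(1) inj_boundary_divisor coordinate_face_facet
    prime_divisor_boundary boundary_divisor_eq_closure)+

end
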